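(* Let $g:\mathbb{R}^n\times\Delta\to\mathbb{R}^r$, with $\Delta\subseteq\mathbb{R}^d$, be of the form $$g(x,\delta) = G(x)\,\delta + H(x),$$ where $G:\mathbb{R}^n\to\mathbb{R}^{r\times d}$ and $H:\mathbb{R}^n\to\mathbb{R}^r$, and suppose the standing regularity assumption (see context) holds. For all $\epsilon,\beta\in(0,1)$, if the number of samples $N$ satisfies $$\sum_{j=0}^{r(d+1)-1}\binom{N}{j}\epsilon^j(1-\epsilon)^{N-j}\le\beta,$$ then with confidence no smaller than $1-\beta$ (that is, with $\mathbb{P}^N$-probability at least $1-\beta$ over $\omega\in\Delta^N$) the solution of $\mathrm{SP}[\omega]$ is feasible for $\mathrm{CCP}(\epsilon)$.
   Context: Setting. $(\Delta,\mathcal{F},\mathbb{P})$ is a probability space with $\Delta\subseteq\mathbb{R}^d$; $\mathcal{X}\subset\mathbb{R}^n$ is a compact convex set; $c\in\mathbb{R}^n$. Vector inequalities are understood element-wise. The chance constrained program with violation level $\epsilon\in(0,1)$ is $$\mathrm{CCP}(\epsilon):\quad \min_{x\in\mathcal{X}} c^\top x\quad\text{s.t.}\quad \mathbb{P}[g(x,\delta)\le 0]\ge 1-\epsilon .$$ Given a multi-sample $\omega=\{\delta^{(1)},\ldots,\delta^{(N)}\}\in\Delta^N$ of i.i.d. samples drawn according to $\mathbb{P}$ (so $\omega$ has law the product measure $\mathbb{P}^N$), the scenario program is $$\mathrm{SP}[\omega]:\quad \min_{x\in\mathcal{X}} c^\top x \quad\text{s.t.}\quad g(x,\delta^{(j)})\le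 0\ \ \forall j\in\{1,\ldots,N\}.$$ Standing regularity assumption. For almost all $\delta\in\Delta$, the function $x\mapsto g(x,\delta)$ is convex and lower semi-continuous (componentwise). For any integer $N$, $\mathrm{SP}[\omega]$ is almost surely feasible, and its optimizer exists and is unique for almost all $\omega\in\Delta^N$. For all $x\in\mathcal{X}$, the mapping $\delta\mapsto g(x,\delta)$ is measurable. (Measurability of the event in the confidence statement is tacitly assumed.) *)

theory Defs
  imports "HOL-Probability.Probability"
begin

definition lower_semicontinuous :: "('a::topological_space \<Rightarrow> real) \<Rightarrow> bool" where
  "lower_semicontinuous f \<longleftrightarrow> (\<forall>x. \<forall>a < f x. \<forall>\<^sub>F y in nhds x. a < f y)"

text \<open>The order on \<open>real ^ 'r\<close> is componentwise, so \<open>g x \<delta> \<le> 0\<close> is an elementwise inequality.\<close>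

definition ccp_feasible_set ::
  "'d measure \<Rightarrow> (real ^ 'n) set \<Rightarrow> (real ^ 'n \<Rightarrow> 'd \<Rightarrow> real ^ 'r) \<Rightarrow> real \<Rightarrow> (real ^ 'n) set" where
  "ccp_feasible_set P X g \<epsilon> = {x \<in> X. measure P {\<delta> \<in> space P. g x \<delta> \<le> 0} \<ge> 1 - \<epsilon>}"

definition sp_feasible_set ::
  "(real ^ 'n) set \<Rightarrow> (real ^ 'n \<Rightarrow> 'd \<Rightarrow> real ^ 'r) \<Rightarrow> nat \<Rightarrow> (nat \<Rightarrow> 'd) \<Rightarrow> (real ^ 'n) set" where
  "sp_feasible_set X g N \<omega> = {x \<in> X. \<forall>j\<in>{1..N}. g x (\<omega> j) \<le> 0}"

definition is_sp_optimizer ::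
  "real ^ 'n \<Rightarrow> (real ^ 'n) set \<Rightarrow> (real ^ 'n \<Rightarrow> 'd \<Rightarrow> real ^ 'r) \<Rightarrow> nat \<Rightarrow> (nat \<Rightarrow> 'd) \<Rightarrow> real ^ 'n \<Rightarrow> bool" where
  "is_sp_optimizer c X g N \<omega> = is_arg_min (\<lambda>x. c \<bullet> x) (\<lambda>x. x \<in> sp_feasible_set X g N \<omega>)"

text \<open>
  The minimiser of the scenario program. It is only meaningful for multi-samples \<open>\<omega>\<close> for which the
  minimiser exists and is unique; elsewhere \<^const>\<open>arg_min_on\<close> makes an arbitrary choice.
\<close>

definition sp_solution ::
  "real ^ 'n \<Rightarrow> (real ^ 'n) set \<Rightarrow> (real ^ 'n \<Rightarrow> 'd \<Rightarrow> real ^ 'r) \<Rightarrow> nat \<Rightarrow> (nat \<Rightarrow> 'd) \<Rightarrow> real ^ 'n" where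
  "sp_solution c X g N \<omega> = arg_min_on (\<lambda>x. c \<bullet> x) (sp_feasible_set X g N \<omega>)"

text \<open>The law \<open>P\<^sup>N\<close> of \<open>N\<close> i.i.d. samples, on functions with extensional domain \<open>{1..N}\<close>.\<close>

abbreviation sample_law :: "nat \<Rightarrow> 'd measure \<Rightarrow> (nat \<Rightarrow> 'd) measure" where
  "sample_law N P \<equiv> Pi\<^sub>M {1..N} (\<lambda>_. P)"

end

theory Submission
  imports Defs
begin

text \<open>
  Relax every sampled constraint \<open>g x \<delta> \<le> 0\<close> to \<open>g x \<delta> \<le> \<rho> * \<bar>\<tau>\<bar>\<close> with an
  independent uniform label \<open>\<tau>\<close>, and add \<open>\<rho> * (x \<bullet> x)\<close> to the objective. The relaxed program
  still has at most \<open>z = r(d + 1)\<close> support constraints, by a Radon-type argument in the space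
  \<open>\<real>\<^sup>z\<close> of the coefficients \<open>(G x, H x)\<close>, but now its support constraints almost surely determine its
  optimum, because the optimal value is convex in each label. Hence almost surely exactly one subset of
  the samples consists of support constraints of its own program and has an optimiser that satisfies
  all other samples. If \<open>V k\<close> is the violation probability of the optimiser for \<open>k\<close> samples and \<open>A k\<close>
  the event that all of them are support constraints, this says that
  \<open>\<Sum>k\<le>z. (N choose k) * E[A k; (1 - V k) ^ (N - k)] = 1\<close> for all \<open>N \<ge> z\<close>. These moment identities
  bound the tail of the violation probability by the binomial sum. Letting \<open>\<rho> \<rightarrow> 0\<close>, the relaxed
  optimisers converge to the unique optimiser of the scenario program, and the bound survives because
  the violation probability is lower semicontinuous.
\<close>

subsection \<open>Moments and the binomial tail\<close>

text \<open>The obstacle is degeneracy. If \<open>P\<close> has atoms, or several samples cut out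
  the same optimum, the support constraints may fail to determine it, and the splitting of the
  sample space by support sets breaks down. The labels remove such ties; the quadratic term makes
  the optimiser of every feasible subprogram unique. Supports may have fewer than \<open>z\<close>
  elements, so the terms with k < z stay, and only their sum is known. Dividing the identity for m +
  z samples by \<open>(m + z) choose z\<close> gives on the right the m-th moment of Beta(1, z), and
  on the left a linear functional on polynomials. The functional is positive because its k-th term
  averages a (z - k)-fold iterated integral of the polynomial. Polynomial majorants of a cut-off
  then bound the tail without any measure being constructed. \<open>G\<close> and \<open>H\<close>
  need not be affine in x: linear algebra is applied to their values at finitely many points, and
  convexity only to the rows of g at a fixed sample.\<close>

definition binomial_cdf :: "nat \<Rightarrow> nat \<Rightarrow> real \<Rightarrow> real" where
  "binomial_cdf z N x = (\<Sum>j<z. real (N choose j) * (1 - x) ^ j * x ^ (N - j))"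

text \<open>Telescoping: one half of the derivative of the newest term cancels the derivative of the
  earlier ones. For 0 < z \<le> N the remainder is the density of Beta(N - z + 1, z), so
  \<open>binomial_cdf z N\<close> is the distribution function of that law on [0, 1].\<close>

lemma binomial_cdf_deriv:
  assumes "z \<le> N"
  shows "(binomial_cdf z N has_real_derivative
    real (N choose z) * real z * x ^ (N - z) * (1 - x) ^ (z - 1)) (at x)"
  using assms
proof (induction z)
  case 0
  have "binomial_cdf 0 N = (\<lambda>x. 0)" by (auto simp: binomial_cdf_def)
  then show ?case by simp
next
  case (Suc z)
  have e: "binomial_cdf (Suc z) N = (\<lambda>x. binomial_cdf z N x + real (N choose z) * (1 - x) ^ z * x ^ (N - z))"
    by (auto simp: binomial_cdf_def)
  have "(Suc z) * (N choose Suc z) = (N - z) * (N choose z)"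
    by (metis binomial_absorb_comp binomial_absorption mult.commute Suc_le_lessD Suc_diff_Suc Suc.prems diff_Suc_Suc times_binomial_minus1_eq choose_reduce_nat)
  then have k: "real (N choose Suc z) * real (Suc z) = real (N choose z) * real (N - z)"
    by (metis mult.commute of_nat_mult)
  have "(binomial_cdf (Suc z) N has_real_derivative
      real (N choose z) * real z * x ^ (N - z) * (1 - x) ^ (z - 1)
      + (real (N choose z) * (real z * (1 - x) ^ (z - 1) * (-1)) * x ^ (N - z)
      + real (N choose z) * (1 - x) ^ z * (real (N - z) * x ^ (N - z - 1)))) (at x)"
    unfolding e using Suc.prems
    by (auto intro!: derivative_eq_intros Suc.IH)
  then show ?case
    unfolding k by (simp add: algebra_simps)
qed

lemma binomial_cdf_at_0: "z \<le> N \<Longrightarrow> binomial_cdf z N 0 = 0"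
  by (auto simp: binomial_cdf_def intro!: sum.neutral)

lemma binomial_cdf_at_1: "0 < z \<Longrightarrow> binomial_cdf z N 1 = 1"
  by (cases z) (auto simp: binomial_cdf_def sum.lessThan_Suc_shift)

lemma binomial_cdf_integral:
  assumes "z \<le> N" "0 \<le> b"
  shows "((\<lambda>y. real (N choose z) * y ^ (N - z) * (real z * (1 - y) ^ (z - 1))) has_integral
    binomial_cdf z N b) {0..b}"
proof -
  have "((\<lambda>y. real (N choose z) * real z * y ^ (N - z) * (1 - y) ^ (z - 1)) has_integral
    (binomial_cdf z N b - binomial_cdf z N 0)) {0..b}"
    by (rule fundamental_theorem_of_calculus[OF assms(2)])
      (use binomial_cdf_deriv[OF assms(1)] in
        \<open>auto simp: has_real_derivative_iff_has_vector_derivative[symmetric] intro: DERIV_subset\<close>)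
  then show ?thesis
    using binomial_cdf_at_0[OF assms(1)] by (simp add: algebra_simps)
qed

text \<open>The weight is the density of Beta(1, z), whose m-th moment is the reciprocal of
  \<open>(m + z) choose z\<close>.\<close>

lemma polynomial_beta_integral:
  assumes "0 < z"
  shows "((\<lambda>y. (\<Sum>m\<le>n. q m * y ^ m) * (real z * (1 - y) ^ (z - 1))) has_integral
    (\<Sum>m\<le>n. q m / real ((m + z) choose z))) {0..1::real}"
proof -
  have "((\<lambda>y. q m * y ^ m * (real z * (1 - y) ^ (z - 1))) has_integral
      q m / real ((m + z) choose z)) {0..1}" for m
  proof -
    have "((\<lambda>y. real ((m + z) choose z) * y ^ (m + z - z) * (real z * (1 - y) ^ (z - 1))) has_integral 1) {0..1}"
      using binomial_cdf_integral[of z "m + z" 1] binomial_cdf_at_1[OF assms] by simp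
    from has_integral_mult_right[OF this, of "q m / real ((m + z) choose z)"] show ?thesis
      by (simp add: field_simps)
  qed
  then have "((\<lambda>y. \<Sum>m\<le>n. q m * y ^ m * (real z * (1 - y) ^ (z - 1))) has_integral
    (\<Sum>m\<le>n. q m / real ((m + z) choose z))) {0..1}"
    by (intro has_integral_sum) auto
  then show ?thesis by (simp add: sum_distrib_right)
qed

text \<open>The sum in the conclusion is the \<open>l\<close>-fold iterated integral from \<open>0\<close> of the polynomial.\<close>

lemma iterated_integral_nonneg:
  fixes q :: "nat \<Rightarrow> real"
  assumes "\<And>y. 0 \<le> y \<Longrightarrow> y \<le> b \<Longrightarrow> 0 \<le> (\<Sum>m\<le>n. q m * y ^ m)"
  assumes "0 \<le> x" "x \<le> b"
  shows "0 \<le> (\<Sum>m\<le>n. q m * (fact m / fact (m + l)) * x ^ (m + l))"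
  using assms(2,3)
proof (induction l arbitrary: x)
  case 0
  then show ?case using assms(1)[of x] by simp
next
  case (Suc l)
  let ?F = "\<lambda>x. \<Sum>m\<le>n. q m * (fact m / fact (m + Suc l)) * x ^ (m + Suc l)"
  let ?f = "\<lambda>x. \<Sum>m\<le>n. q m * (fact m / fact (m + l)) * x ^ (m + l)"
  have "(?F has_real_derivative ?f y) (at y)" for y
  proof -
    have "((\<lambda>x. q m * (fact m / fact (m + Suc l)) * x ^ (m + Suc l)) has_real_derivative
        q m * (fact m / fact (m + l)) * y ^ (m + l)) (at y)" for m
    proof -
      have "((\<lambda>x. x ^ Suc (m + l)) has_real_derivative real (Suc (m + l)) * y ^ (m + l)) (at y)"
        using DERIV_pow[of "Suc (m + l)" y] by simp
      from DERIV_cmult[OF this, of "q m * (fact m / fact (Suc (m + l)))"]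
      have "((\<lambda>x. q m * (fact m / fact (Suc (m + l))) * x ^ Suc (m + l)) has_real_derivative
          q m * (fact m / fact (Suc (m + l))) * (real (Suc (m + l)) * y ^ (m + l))) (at y)" .
      moreover have "(fact (Suc (m + l)) :: real) = real (Suc (m + l)) * fact (m + l)"
        by (rule fact_Suc)
      moreover have "real (Suc (m + l)) \<noteq> 0" by simp
      ultimately show ?thesis
        by (simp add: mult.assoc)
    qed
    then show ?thesis by (intro DERIV_sum) auto
  qed
  moreover have "0 \<le> ?f y" if "0 \<le> y" "y \<le> x" for y
    using Suc.IH[of y] Suc.prems that by linarith
  ultimately have "?F 0 \<le> ?F x"
    by (intro DERIV_nonneg_imp_nondecreasing[OF Suc.prems(1)]) blast
  then show ?case by simp
qed

text \<open>The last factor is the coefficient produced by integrating y^m from 0 exactly z - k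
  times, which brings \<open>iterated_integral_nonneg\<close> into play.\<close>

lemma binomial_ratio:
  assumes "k \<le> z"
  shows "real ((m + z) choose k) / real ((m + z) choose z) = fact z / fact k * (fact m / fact (m + (z - k)))"
  using assms by (simp add: binomial_fact field_simps)

text \<open>Both sides are values of one linear map on polynomials, z! / k! times the (z - k)-fold
  integral from 0 evaluated at b, which preserves inequalities on [0, b]. On the left it is applied
  to c * y^(N - z), where m + z = N.\<close>

lemma binomial_moment_mono:
  fixes q :: "nat \<Rightarrow> real"
  assumes "k \<le> z" "z \<le> N" "0 \<le> b"
    and q: "\<And>y. 0 \<le> y \<Longrightarrow> y \<le> b \<Longrightarrow> c * y ^ (N - z) \<le> (\<Sum>m\<le>n. q m * y ^ m)"
  shows "c / real (N choose z) * (real (N choose k) * b ^ (N - k))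
    \<le> (\<Sum>m\<le>n. q m / real ((m + z) choose z) * (real ((m + z) choose k) * b ^ (m + z - k)))"
proof -
  define n' where "n' = max n (N - z)"
  define p where "p m = (if m \<le> n then q m else 0) - (if m = N - z then c else 0)" for m
  have split: "(\<Sum>m\<le>n'. p m * h m) = (\<Sum>m\<le>n. q m * h m) - c * h (N - z)" for h :: "nat \<Rightarrow> real"
  proof -
    have "(\<Sum>m\<le>n'. p m * h m) =
        (\<Sum>m\<le>n'. if m \<le> n then q m * h m else 0) - (\<Sum>m\<le>n'. if m = N - z then c * h m else 0)"
      by (auto simp: p_def left_diff_distrib sum_subtractf if_distrib[of "\<lambda>x. x * _"] cong: if_cong)
    also have "(\<Sum>m\<le>n'. if m \<le> n then q m * h m else 0) = (\<Sum>m\<le>n. q m * h m)"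
      by (rule sum.mono_neutral_cong_right) (auto simp: n'_def)
    finally show ?thesis by (simp add: n'_def)
  qed
  have "0 \<le> (\<Sum>m\<le>n'. p m * (fact m / fact (m + (z - k))) * b ^ (m + (z - k)))"
    by (rule iterated_integral_nonneg[of b]) (use assms in \<open>auto simp: split\<close>)
  then have "0 \<le> fact z / fact k * (\<Sum>m\<le>n'. p m * (fact m / fact (m + (z - k)) * b ^ (m + (z - k))))"
    by (simp add: mult.assoc)
  also have "\<dots> = (\<Sum>m\<le>n'. p m * (fact z / fact k * (fact m / fact (m + (z - k))) * b ^ (m + z - k)))"
    using assms(1) by (simp add: sum_distrib_left mult_ac)
  also have "\<dots> = (\<Sum>m\<le>n'. p m * (real ((m + z) choose k) / real ((m + z) choose z) * b ^ (m + z - k)))"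
    by (simp only: binomial_ratio[OF assms(1)])
  finally show ?thesis
    unfolding split using assms(2) by (simp add: algebra_simps)
qed

lemma polynomial_majorant:
  fixes \<epsilon> \<eta> :: real
  assumes "0 < \<eta>" "\<eta> < \<epsilon>" "\<epsilon> < 1" "0 < z" "z \<le> N"
  obtains q :: "nat \<Rightarrow> real" and n where
    "\<And>y. 0 \<le> y \<Longrightarrow> y \<le> 1 - \<epsilon> \<Longrightarrow> real (N choose z) * y ^ (N - z) \<le> (\<Sum>m\<le>n. q m * y ^ m)"
    "\<And>y. 0 \<le> y \<Longrightarrow> y \<le> 1 \<Longrightarrow> 0 \<le> (\<Sum>m\<le>n. q m * y ^ m)"
    "(\<Sum>m\<le>n. q m / real ((m + z) choose z)) \<le> binomial_cdf z N (1 - \<epsilon> + \<eta>) + 2 * \<eta>"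
proof -
  define ramp where "ramp y = max 0 (min 1 ((1 - \<epsilon> + \<eta> - y) / \<eta>))" for y
  define \<phi> where "\<phi> y = real (N choose z) * y ^ (N - z) * ramp y" for y
  \<comment> \<open>The ramp makes the cut-off at 1 - \<epsilon> continuous, as Weierstrass
    approximation requires. Approximating \<phi> + \<eta> within \<eta> puts the polynomial between
    \<phi> and \<phi> + 2 * \<eta>, so it majorises \<phi> and costs at most 2 * \<eta>, the weight
    having mass 1.\<close>
  have "continuous_on {0..1} (\<lambda>y. \<phi> y + \<eta>)"
    unfolding \<phi>_def ramp_def using assms(1) by (intro continuous_intros) auto
  then obtain h where h: "real_polynomial_function h"
      and h_close: "\<And>y. y \<in> {0..1} \<Longrightarrow> \<bar>\<phi> y + \<eta> - h y\<bar> < \<eta>"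
    using Stone_Weierstrass_real_polynomial_function[of "{0..1::real}" "\<lambda>y. \<phi> y + \<eta>" \<eta>] assms(1) by auto
  obtain q n where qn: "h = (\<lambda>y. \<Sum>m\<le>n. q m * y ^ m)"
    using h unfolding real_polynomial_function_iff_sum by auto
  have lower: "\<phi> y \<le> (\<Sum>m\<le>n. q m * y ^ m)" and upper: "(\<Sum>m\<le>n. q m * y ^ m) \<le> \<phi> y + 2 * \<eta>"
    if "0 \<le> y" "y \<le> 1" for y
    using h_close[of y] that unfolding qn by (auto simp: abs_less_iff)
  show thesis
  proof (rule that[of q n])
    fix y :: real assume y: "0 \<le> y" "y \<le> 1 - \<epsilon>"
    then have "ramp y = 1" using assms(1) by (simp add: ramp_def field_simps)
    then show "real (N choose z) * y ^ (N - z) \<le> (\<Sum>m\<le>n. q m * y ^ m)"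
      using lower[of y] y assms by (simp add: \<phi>_def)
  next
    fix y :: real assume y: "0 \<le> y" "y \<le> 1"
    have "0 \<le> \<phi> y" using y by (simp add: \<phi>_def ramp_def)
    then show "0 \<le> (\<Sum>m\<le>n. q m * y ^ m)"
      using lower[OF y] by linarith
  next
    let ?b = "1 - \<epsilon> + \<eta>" and ?w = "\<lambda>y. real z * (1 - y) ^ (z - 1)"
    have "((\<lambda>y. if y \<in> {0..?b} then real (N choose z) * y ^ (N - z) * ?w y else 0)
        has_integral binomial_cdf z N ?b) {0..1}"
      using assms by (subst has_integral_restrict) (auto intro!: binomial_cdf_integral simp del: One_nat_def)
    moreover have "((\<lambda>y. 2 * \<eta> * ?w y) has_integral 2 * \<eta>) {0..1}"
      using has_integral_mult_right[OF polynomial_beta_integral[OF assms(4), where n = 0 and q = "\<lambda>_. 1"], of "2 * \<eta>"]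
      by simp
    ultimately have "((\<lambda>y. (if y \<in> {0..?b} then real (N choose z) * y ^ (N - z) * ?w y else 0)
        + 2 * \<eta> * ?w y) has_integral binomial_cdf z N ?b + 2 * \<eta>) {0..1}"
      by (rule has_integral_add)
    moreover have "(\<Sum>m\<le>n. q m * y ^ m) * ?w y
        \<le> (if y \<in> {0..?b} then real (N choose z) * y ^ (N - z) * ?w y else 0) + 2 * \<eta> * ?w y"
      if "y \<in> {0..1}" for y
    proof -
      have y: "0 \<le> y" "y \<le> 1" using that by auto
      have "ramp y \<le> (if y \<le> ?b then 1 else 0)"
        using assms(1) by (auto simp: ramp_def divide_nonpos_pos)
      then have "\<phi> y \<le> (if y \<le> ?b then real (N choose z) * y ^ (N - z) else 0)"
        unfolding \<phi>_def using y(1) mult_left_mono[of "ramp y" "if y \<le> ?b then 1 else 0" "real (N choose z) * y ^ (N - z)"]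
        by (auto split: if_splits)
      then have "(\<Sum>m\<le>n. q m * y ^ m) \<le> (if y \<le> ?b then real (N choose z) * y ^ (N - z) else 0) + 2 * \<eta>"
        using upper[OF y] by linarith
      then have "(\<Sum>m\<le>n. q m * y ^ m) * ?w y
          \<le> ((if y \<le> ?b then real (N choose z) * y ^ (N - z) else 0) + 2 * \<eta>) * ?w y"
        using y by (intro mult_right_mono) auto
      then show ?thesis using y by (auto simp: algebra_simps split: if_splits)
    qed
    ultimately show "(\<Sum>m\<le>n. q m / real ((m + z) choose z)) \<le> binomial_cdf z N ?b + 2 * \<eta>"
      using has_integral_le[OF polynomial_beta_integral[OF assms(4)]] by blast
  qed
qed

text \<open>
  The hypothesis fixes all moments of a mixture of the laws of \<open>1 - V k\<close> and beta variables, so this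
  mixture has a beta law by the Weierstrass theorem; its distribution function is \<^const>\<open>binomial_cdf\<close>.
\<close>

lemma binomial_moment_tail_bound:
  fixes M :: "nat \<Rightarrow> 'a measure" and A V :: "nat \<Rightarrow> 'a \<Rightarrow> real"
  assumes fin: "\<And>k. finite_measure (M k)"
    and A_meas [measurable]: "\<And>k. A k \<in> borel_measurable (M k)"
    and A: "\<And>k x. 0 \<le> A k x" "\<And>k x. A k x \<le> 1"
    and V_meas [measurable]: "\<And>k. V k \<in> borel_measurable (M k)"
    and V: "\<And>k x. 0 \<le> V k x" "\<And>k x. V k x \<le> 1"
    and z: "0 < z" "z \<le> N"
    and \<epsilon>: "0 < \<epsilon>" "\<epsilon> < 1"
    and moments: "\<And>N. z \<le> N \<Longrightarrow>
      (\<Sum>k\<le>z. real (N choose k) * (\<integral>x. A k x * (1 - V k x) ^ (N - k) \<partial>M k)) = 1"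
  shows "(\<Sum>k\<le>z. real (N choose k) * (\<integral>x. A k x * of_bool (\<epsilon> < V k x) * (1 - V k x) ^ (N - k) \<partial>M k))
    \<le> binomial_cdf z N (1 - \<epsilon>)" (is "?L \<le> _")
proof -
  have int: "integrable (M k) (\<lambda>x. A k x * (1 - V k x) ^ m)"
    "integrable (M k) (\<lambda>x. A k x * of_bool (\<epsilon> < V k x) * (1 - V k x) ^ m)" for k m
  proof -
    interpret finite_measure "M k" by (rule fin)
    have b: "\<bar>A k x * (1 - V k x) ^ m\<bar> \<le> 1" for x
      using A[of k x] V[of k x] by (auto simp: abs_mult power_abs intro!: mult_le_one power_le_one)
    then show "integrable (M k) (\<lambda>x. A k x * (1 - V k x) ^ m)"
      by (intro integrable_const_bound[of _ 1]) auto
    have "\<bar>A k x * of_bool (\<epsilon> < V k x) * (1 - V k x) ^ m\<bar> \<le> 1" for x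
      using b[of x] by (cases "\<epsilon> < V k x") auto
    then show "integrable (M k) (\<lambda>x. A k x * of_bool (\<epsilon> < V k x) * (1 - V k x) ^ m)"
      by (intro integrable_const_bound[of _ 1]) auto
  qed
  have bound: "?L \<le> binomial_cdf z N (1 - \<epsilon> + \<eta>) + 2 * \<eta>" if \<eta>: "0 < \<eta>" "\<eta> < \<epsilon>" for \<eta>
  proof -
    obtain q n where q:
      "\<And>y. 0 \<le> y \<Longrightarrow> y \<le> 1 - \<epsilon> \<Longrightarrow> real (N choose z) * y ^ (N - z) \<le> (\<Sum>m\<le>n. q m * y ^ m)"
      "\<And>y. 0 \<le> y \<Longrightarrow> y \<le> 1 \<Longrightarrow> 0 \<le> (\<Sum>m\<le>n. q m * y ^ m)"
      "(\<Sum>m\<le>n. q m / real ((m + z) choose z)) \<le> binomial_cdf z N (1 - \<epsilon> + \<eta>) + 2 * \<eta>"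
      using polynomial_majorant[OF \<eta> \<epsilon>(2) z] by blast
    let ?\<Phi> = "\<lambda>k b. \<Sum>m\<le>n. q m / real ((m + z) choose z) * (real ((m + z) choose k) * b ^ (m + z - k))"
    \<comment> \<open>If V k x > \<epsilon>, the upper limit 1 - V k x stays below 1 - \<epsilon>,
      where q dominates the power of y. Otherwise c = 0 is used, and nonnegativity of q
      suffices.\<close>
    have pt: "real (N choose k) * (A k x * of_bool (\<epsilon> < V k x) * (1 - V k x) ^ (N - k)) \<le> A k x * ?\<Phi> k (1 - V k x)"
      if k: "k \<le> z" for k x
    proof (cases "\<epsilon> < V k x")
      case True
      have "real (N choose z) / real (N choose z) * (real (N choose k) * (1 - V k x) ^ (N - k)) \<le> ?\<Phi> k (1 - V k x)"
        by (rule binomial_moment_mono[OF k z(2)]) (use V[of k x] True q(1) in auto)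
      then have "real (N choose k) * (1 - V k x) ^ (N - k) \<le> ?\<Phi> k (1 - V k x)"
        using z(2) by simp
      from mult_left_mono[OF this A(1)[of k x]] show ?thesis using True by (simp add: mult_ac)
    next
      case False
      have "0 / real (N choose z) * (real (N choose k) * (1 - V k x) ^ (N - k)) \<le> ?\<Phi> k (1 - V k x)"
        by (rule binomial_moment_mono[OF k z(2)]) (use V[of k x] q(2) in auto)
      then show ?thesis using False A(1)[of k x] by simp
    qed
    have "real (N choose k) * (\<integral>x. A k x * of_bool (\<epsilon> < V k x) * (1 - V k x) ^ (N - k) \<partial>M k)
        \<le> (\<Sum>m\<le>n. q m / real ((m + z) choose z) *
            (real ((m + z) choose k) * (\<integral>x. A k x * (1 - V k x) ^ (m + z - k) \<partial>M k)))"
      if k: "k \<le> z" for k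
    proof -
      have eq: "A k x * ?\<Phi> k (1 - V k x) = (\<Sum>m\<le>n. q m / real ((m + z) choose z) *
          (real ((m + z) choose k) * (A k x * (1 - V k x) ^ (m + z - k))))" for x
        by (simp add: sum_distrib_left mult_ac)
      have "real (N choose k) * (\<integral>x. A k x * of_bool (\<epsilon> < V k x) * (1 - V k x) ^ (N - k) \<partial>M k)
        = (\<integral>x. real (N choose k) * (A k x * of_bool (\<epsilon> < V k x) * (1 - V k x) ^ (N - k)) \<partial>M k)"
        by simp
      also have "\<dots> \<le> (\<integral>x. (\<Sum>m\<le>n. q m / real ((m + z) choose z) *
          (real ((m + z) choose k) * (A k x * (1 - V k x) ^ (m + z - k)))) \<partial>M k)"
        by (rule integral_mono)
          (intro Bochner_Integration.integrable_sum integrable_mult_right int | rule pt[OF k, unfolded eq])+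
      also have "\<dots> = (\<Sum>m\<le>n. q m / real ((m + z) choose z) *
            (real ((m + z) choose k) * (\<integral>x. A k x * (1 - V k x) ^ (m + z - k) \<partial>M k)))"
        by (simp add: int)
      finally show ?thesis .
    qed
    then have "?L \<le> (\<Sum>k\<le>z. \<Sum>m\<le>n. q m / real ((m + z) choose z) *
            (real ((m + z) choose k) * (\<integral>x. A k x * (1 - V k x) ^ (m + z - k) \<partial>M k)))"
      by (intro sum_mono) auto
    also have "\<dots> = (\<Sum>m\<le>n. q m / real ((m + z) choose z) *
            (\<Sum>k\<le>z. real ((m + z) choose k) * (\<integral>x. A k x * (1 - V k x) ^ (m + z - k) \<partial>M k)))"
      by (subst sum.swap) (simp add: sum_distrib_left)
    also have "\<dots> = (\<Sum>m\<le>n. q m / real ((m + z) choose z))"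
      by (simp add: moments)
    finally show ?thesis using q(3) by linarith
  qed
  have *: "((\<lambda>\<eta>. binomial_cdf z N (1 - \<epsilon> + \<eta>) + 2 * \<eta>) \<longlongrightarrow> binomial_cdf z N (1 - \<epsilon> + 0) + 2 * 0) (at_right 0)"
    unfolding binomial_cdf_def by (intro tendsto_intros)
  have "eventually (\<lambda>\<eta>. ?L \<le> binomial_cdf z N (1 - \<epsilon> + \<eta>) + 2 * \<eta>) (at_right 0)"
    unfolding eventually_at_right_field using \<epsilon>(1) bound by blast
  from tendsto_lowerbound[OF * this] show ?thesis by simp
qed

subsection \<open>Nondegenerate scenario values\<close>

lemma sum_Pow_card:
  fixes h :: "nat \<Rightarrow> real"
  assumes J: "finite J" "z \<le> card J" and h: "\<And>k. z < k \<Longrightarrow> h k = 0"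
  shows "(\<Sum>I\<in>Pow J. h (card I)) = (\<Sum>k\<le>z. real (card J choose k) * h k)"
proof -
  have "(\<Sum>I\<in>Pow J. h (card I)) = (\<Sum>k\<le>card J. \<Sum>I\<in>{I\<in>Pow J. card I = k}. h (card I))"
    using J(1) by (intro sum.group[symmetric]) (auto intro: card_mono)
  also have "\<dots> = (\<Sum>k\<le>card J. real (card J choose k) * h k)"
    using n_subsets[OF J(1)] by (intro sum.cong) auto
  also have "\<dots> = (\<Sum>k\<le>z. real (card J choose k) * h k)"
    using J(2) h by (intro sum.mono_neutral_right) auto
  finally show ?thesis .
qed

text \<open>
  The value \<open>w A\<close> stands for the optimal value of the program with constraints \<open>A\<close>, so a further
  constraint is violated by the optimiser iff adding it raises the value.
\<close>

locale scenario_value = prob_space Q for Q :: "'s measure" +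
  fixes w :: "'s set \<Rightarrow> real" and z :: nat
  assumes value_measurable: "\<And>I :: nat set. finite I \<Longrightarrow> (\<lambda>\<omega>. w (\<omega> ` I)) \<in> borel_measurable (Pi\<^sub>M I (\<lambda>_. Q))"
    and value_mono: "finite B \<Longrightarrow> A \<subseteq> B \<Longrightarrow> w A \<le> w B"
    and value_local: "finite A \<Longrightarrow> finite B \<Longrightarrow> (\<And>s. s \<in> B \<Longrightarrow> w (insert s A) = w A) \<Longrightarrow> w (A \<union> B) = w A"
    and value_helly: "finite A \<Longrightarrow> z < card A \<Longrightarrow> \<exists>a\<in>A. w (A - {a}) = w A"
    and value_nondegenerate: "\<And>I :: nat set. finite I \<Longrightarrow>
      AE \<omega> in Pi\<^sub>M I (\<lambda>_. Q). w (\<omega> ` {j \<in> I. w (\<omega> ` (I - {j})) < w (\<omega> ` I)}) = w (\<omega> ` I)"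
begin

abbreviation "QI (I :: nat set) \<equiv> Pi\<^sub>M I (\<lambda>_. Q)"

definition violated :: "'s set \<Rightarrow> 's \<Rightarrow> bool" where
  "violated A s \<longleftrightarrow> w A < w (insert s A)"

definition violation :: "'s set \<Rightarrow> real" where
  "violation A = prob {s \<in> space Q. violated A s}"

definition all_support :: "nat set \<Rightarrow> (nat \<Rightarrow> 's) \<Rightarrow> bool" where
  "all_support I \<omega> \<longleftrightarrow> (\<forall>j\<in>I. w (\<omega> ` (I - {j})) < w (\<omega> ` I))"

definition support :: "nat set \<Rightarrow> (nat \<Rightarrow> 's) \<Rightarrow> nat set" where
  "support J \<omega> = {j \<in> J. w (\<omega> ` (J - {j})) < w (\<omega> ` J)}"

lemma all_support_card:
  assumes I: "finite I" and sup: "all_support I \<omega>"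
  shows "card I \<le> z"
proof (rule ccontr)
  assume "\<not> card I \<le> z"
  have inj: "inj_on \<omega> I"
  proof (rule inj_onI, rule ccontr)
    fix i j assume "i \<in> I" "j \<in> I" "\<omega> i = \<omega> j" "i \<noteq> j"
    then have "\<omega> i \<in> \<omega> ` (I - {j})" by blast
    moreover have "\<omega> ` I = insert (\<omega> i) (\<omega> ` (I - {j}))"
      using \<open>\<omega> i = \<omega> j\<close> \<open>j \<in> I\<close> by auto
    ultimately have "\<omega> ` (I - {j}) = \<omega> ` I" by (simp add: insert_absorb)
    then show False using sup \<open>j \<in> I\<close> by (auto simp: all_support_def)
  qed
  then have "z < card (\<omega> ` I)" using \<open>\<not> card I \<le> z\<close> by (simp add: card_image)
  then obtain j where "j \<in> I" "w (\<omega> ` I - {\<omega> j}) = w (\<omega> ` I)"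
    using value_helly[of "\<omega> ` I"] I by auto
  moreover have "\<omega> ` I - {\<omega> j} = \<omega> ` (I - {j})"
    using inj \<open>j \<in> I\<close> by (auto simp: inj_on_def)
  ultimately show False using sup by (auto simp: all_support_def)
qed

text \<open>If no sample outside I is violated, locality gives I the value of J, so I contains every
  support constraint of J. Dropping a further element of I would leave at least the value of the
  support set, which \<open>full\<close> equates with that of J, contradicting
  \<open>all_support\<close>.\<close>

lemma support_unique:
  assumes J: "finite J" and I: "I \<subseteq> J" and full: "w (\<omega> ` support J \<omega>) = w (\<omega> ` J)"
  shows "all_support I \<omega> \<and> (\<forall>j\<in>J-I. \<not> violated (\<omega> ` I) (\<omega> j)) \<longleftrightarrow> I = support J \<omega>" (is "?L \<longleftrightarrow> ?R")
proof
  assume L: ?L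
  have "w (insert s (\<omega> ` I)) = w (\<omega> ` I)" if "s \<in> \<omega> ` (J - I)" for s
  proof -
    have "\<not> w (\<omega> ` I) < w (insert s (\<omega> ` I))" using L that by (auto simp: violated_def)
    moreover have "w (\<omega> ` I) \<le> w (insert s (\<omega> ` I))"
      using finite_subset[OF I J] by (intro value_mono) auto
    ultimately show ?thesis by linarith
  qed
  then have "w (\<omega> ` I \<union> \<omega> ` (J - I)) = w (\<omega> ` I)"
    using J finite_subset[OF I J] by (intro value_local) auto
  moreover have "\<omega> ` I \<union> \<omega> ` (J - I) = \<omega> ` J" using I by auto
  ultimately have eq: "w (\<omega> ` J) = w (\<omega> ` I)" by simp
  have "support J \<omega> \<subseteq> I"
  proof (rule subsetI, rule ccontr)
    fix j assume j: "j \<in> support J \<omega>" "j \<notin> I"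
    then have "w (\<omega> ` I) \<le> w (\<omega> ` (J - {j}))" using I J by (intro value_mono) auto
    then show False using j eq by (simp add: support_def)
  qed
  moreover have "I \<subseteq> support J \<omega>"
  proof (rule subsetI, rule ccontr)
    fix j assume j: "j \<in> I" "j \<notin> support J \<omega>"
    then have "w (\<omega> ` support J \<omega>) \<le> w (\<omega> ` (I - {j}))"
      using \<open>support J \<omega> \<subseteq> I\<close> finite_subset[OF I J] by (intro value_mono) auto
    moreover have "w (\<omega> ` (I - {j})) < w (\<omega> ` I)" using L j by (auto simp: all_support_def)
    ultimately show False using eq full by linarith
  qed
  ultimately show ?R by blast
next
  assume R: ?R
  have "w (\<omega> ` (support J \<omega> - {j})) < w (\<omega> ` support J \<omega>)" if "j \<in> support J \<omega>" for j
  proof -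
    have "w (\<omega> ` (support J \<omega> - {j})) \<le> w (\<omega> ` (J - {j}))"
      using J by (intro value_mono) (auto simp: support_def)
    then show ?thesis using that full by (simp add: support_def)
  qed
  moreover have "w (insert (\<omega> j) (\<omega> ` support J \<omega>)) \<le> w (\<omega> ` support J \<omega>)" if "j \<in> J" for j
    unfolding full using J that by (intro value_mono) (auto simp: support_def)
  ultimately show ?L unfolding R all_support_def violated_def by (auto simp: not_less)
qed

text \<open>Equal values stand for equal optimisers, but only monotonicity and locality are
  available here: no t in B raises the value of A, so if s does not either, locality keeps the value
  of B with s at that of A.\<close>

lemma violated_cong:
  assumes B: "finite B" "A \<subseteq> B" and eq: "w A = w B"
  shows "violated A s \<longleftrightarrow> violated B s"
proof
  assume "violated A s"
  moreover have "w (insert s A) \<le> w (insert s B)" using B by (intro value_mono) auto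
  ultimately show "violated B s" using eq by (simp add: violated_def)
next
  have A: "finite A" using B by (rule finite_subset[rotated])
  assume vB: "violated B s"
  show "violated A s"
  proof (rule ccontr)
    assume "\<not> violated A s"
    moreover have "w A \<le> w (insert s A)" using A by (intro value_mono) auto
    ultimately have "w (insert s A) = w A" by (simp add: violated_def)
    moreover have "w (insert t A) = w A" if "t \<in> B" for t
    proof (rule antisym)
      show "w (insert t A) \<le> w A" unfolding eq using B that by (intro value_mono) auto
      show "w A \<le> w (insert t A)" using A by (intro value_mono) auto
    qed
    ultimately have "w (A \<union> insert s B) = w A" using A B by (intro value_local) auto
    moreover have "A \<union> insert s B = insert s B" using B by auto
    ultimately show False using vB eq by (simp add: violated_def)
  qed
qed

lemma violation_cong:
  "finite B \<Longrightarrow> A \<subseteq> B \<Longrightarrow> w A = w B \<Longrightarrow> violation A = violation B"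
  using violated_cong[of B A] by (simp add: violation_def)

lemma violation_bounds: "0 \<le> violation A" "violation A \<le> 1"
  by (simp_all add: violation_def)

section \<open>Measurability of values, violation probabilities and support events\<close>

lemma value_measurable_subset:
  assumes "finite J" "I \<subseteq> J"
  shows "(\<lambda>\<omega>. w (\<omega> ` I)) \<in> borel_measurable (QI J)"
proof -
  have "(\<lambda>\<omega>. w (restrict \<omega> I ` I)) \<in> borel_measurable (QI J)"
    by (rule measurable_compose[OF measurable_restrict_subset[OF assms(2)] value_measurable])
      (use assms finite_subset in auto)
  then show ?thesis by simp
qed

lemma value_insert_measurable:
  assumes "finite I"
  shows "(\<lambda>x. w (insert (snd x) (fst x ` I))) \<in> borel_measurable (QI I \<Otimes>\<^sub>M Q)"
proof -
  \<comment> \<open>A fresh index turns the additional sample into one more coordinate, so that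
    \<open>value_measurable\<close> applies.\<close>
  obtain j where j: "j \<notin> I" using ex_new_if_finite[OF infinite_UNIV_nat assms] by blast
  have "(\<lambda>x. w ((case x of (f, y) \<Rightarrow> f(j := y)) ` insert j I)) \<in> borel_measurable (QI I \<Otimes>\<^sub>M Q)"
    by (rule measurable_compose[OF measurable_add_dim value_measurable]) (use assms in auto)
  moreover have "(case x of (f, y) \<Rightarrow> f(j := y)) ` insert j I = insert (snd x) (fst x ` I)"
    for x :: "(nat \<Rightarrow> 's) \<times> 's"
    using j by (auto simp: image_iff split: prod.splits)
  ultimately show ?thesis by simp
qed

lemma violated_sets:
  assumes "finite I"
  shows "{x \<in> space (QI I \<Otimes>\<^sub>M Q). violated (fst x ` I) (snd x)} \<in> sets (QI I \<Otimes>\<^sub>M Q)"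
proof -
  note [measurable] = value_insert_measurable[OF assms] value_measurable[OF assms]
  show ?thesis unfolding violated_def by measurable
qed

lemma violated_section_sets:
  assumes "finite I" "x \<in> space (QI I)"
  shows "{s \<in> space Q. violated (x ` I) s} \<in> sets Q"
proof -
  have "Pair x -` {x \<in> space (QI I \<Otimes>\<^sub>M Q). violated (fst x ` I) (snd x)} \<in> sets Q"
    by (rule sets_Pair1[OF violated_sets[OF assms(1)]])
  moreover have "Pair x -` {x \<in> space (QI I \<Otimes>\<^sub>M Q). violated (fst x ` I) (snd x)}
      = {s \<in> space Q. violated (x ` I) s}"
    using assms(2) by (auto simp: space_pair_measure)
  ultimately show ?thesis by simp
qed

lemma violation_measurable:
  assumes "finite I"
  shows "(\<lambda>\<omega>. violation (\<omega> ` I)) \<in> borel_measurable (QI I)"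
proof -
  let ?S = "{x \<in> space (QI I \<Otimes>\<^sub>M Q). violated (fst x ` I) (snd x)}"
  have "(\<lambda>\<omega>. enn2real (emeasure Q (Pair \<omega> -` ?S))) \<in> borel_measurable (QI I)"
    using measurable_emeasure_Pair[OF violated_sets[OF assms]] by measurable
  moreover have "enn2real (emeasure Q (Pair \<omega> -` ?S)) = violation (\<omega> ` I)" if "\<omega> \<in> space (QI I)" for \<omega>
    unfolding violation_def measure_def using that
    by (intro arg_cong[where f=enn2real] arg_cong[where f="emeasure Q"]) (auto simp: space_pair_measure)
  ultimately show ?thesis by (subst measurable_cong[of "QI I", symmetric]) auto
qed

lemma violation_measurable_subset:
  assumes "finite J" "I \<subseteq> J"
  shows "(\<lambda>\<omega>. violation (\<omega> ` I)) \<in> borel_measurable (QI J)"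
proof -
  have "(\<lambda>\<omega>. violation (restrict \<omega> I ` I)) \<in> borel_measurable (QI J)"
    by (rule measurable_compose[OF measurable_restrict_subset[OF assms(2)] violation_measurable])
      (use assms finite_subset in auto)
  then show ?thesis by simp
qed

lemma all_support_sets:
  assumes "finite J" "I \<subseteq> J"
  shows "{\<omega> \<in> space (QI J). all_support I \<omega>} \<in> sets (QI J)"
proof -
  have "finite I" using assms finite_subset by auto
  moreover have "{\<omega> \<in> space (QI J). w (\<omega> ` (I - {j})) < w (\<omega> ` I)} \<in> sets (QI J)" for j
    using assms by (intro borel_measurable_less value_measurable_subset) auto
  ultimately show ?thesis
    unfolding all_support_def by (intro sets.sets_Collect_finite_All) auto
qed

lemma violated_component_sets:
  assumes "finite J" "I \<subseteq> J" "j \<in> J"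
  shows "{\<omega> \<in> space (QI J). violated (\<omega> ` I) (\<omega> j)} \<in> sets (QI J)"
proof -
  have "{\<omega> \<in> space (QI J). w (\<omega> ` I) < w (\<omega> ` insert j I)} \<in> sets (QI J)"
    using assms by (intro borel_measurable_less value_measurable_subset) auto
  then show ?thesis by (simp add: violated_def)
qed

section \<open>Decomposition of the sample space by support sets\<close>

sublocale P: product_prob_space "\<lambda>_ :: nat. Q" ..

lemma prob_not_violated:
  assumes I: "finite I" "x \<in> space (QI I)" and K: "finite K"
  shows "emeasure (QI K) {y \<in> space (QI K). \<forall>j\<in>K. \<not> violated (x ` I) (y j)}
    = ennreal ((1 - violation (x ` I)) ^ card K)"
proof -
  let ?G = "{s \<in> space Q. \<not> violated (x ` I) s}"
  have G: "?G = space Q - {s \<in> space Q. violated (x ` I) s}" by auto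
  have "?G \<in> sets Q" unfolding G using violated_section_sets[OF I] by auto
  moreover have "{y \<in> space (QI K). \<forall>j\<in>K. \<not> violated (x ` I) (y j)} = Pi\<^sub>E K (\<lambda>_. ?G)"
    by (auto simp: space_PiM PiE_iff extensional_def)
  ultimately have "emeasure (QI K) {y \<in> space (QI K). \<forall>j\<in>K. \<not> violated (x ` I) (y j)} = (\<Prod>j\<in>K. emeasure Q ?G)"
    using K by (simp add: P.emeasure_PiM)
  also have "emeasure Q ?G = ennreal (1 - violation (x ` I))"
    unfolding G violation_def emeasure_eq_measure using prob_compl[OF violated_section_sets[OF I]] by simp
  finally show ?thesis
    using violation_bounds by (simp add: ennreal_power)
qed

text \<open>For I inside J this says almost surely, by \<open>support_unique\<close>, that I is the
  support set of J.\<close>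

definition selects :: "nat set \<Rightarrow> nat set \<Rightarrow> (nat \<Rightarrow> 's) \<Rightarrow> bool" where
  "selects J I \<omega> \<longleftrightarrow> all_support I \<omega> \<and> (\<forall>j\<in>J-I. \<not> violated (\<omega> ` I) (\<omega> j))"

lemma selects_sets:
  assumes "finite J" "I \<subseteq> J" "Measurable.pred borel C"
  shows "{\<omega> \<in> space (QI J). selects J I \<omega> \<and> C (violation (\<omega> ` I))} \<in> sets (QI J)"
proof -
  have "{\<omega> \<in> space (QI J). \<forall>j\<in>J-I. \<not> violated (\<omega> ` I) (\<omega> j)} \<in> sets (QI J)"
    using assms by (intro sets.sets_Collect_finite_All sets.sets_Collect_neg violated_component_sets) auto
  moreover have "{\<omega> \<in> space (QI J). C (violation (\<omega> ` I))} \<in> sets (QI J)"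
    using measurable_compose[OF violation_measurable_subset[OF assms(1,2)] assms(3)]
    by (simp add: pred_def)
  ultimately show ?thesis
    unfolding selects_def using all_support_sets[OF assms(1,2)]
    by (intro sets.sets_Collect_conj) auto
qed

text \<open>Given the samples in I, the remaining ones are independent and each satisfies the
  optimiser with probability 1 minus the violation, hence the power. The predicate C serves two
  purposes: constantly true it yields the moment identities, and as \<open>\<epsilon> < _\<close>
  the tail.\<close>

lemma prob_selects:
  assumes J: "finite J" "I \<subseteq> J" and C: "Measurable.pred borel C"
  shows "measure (QI J) {\<omega> \<in> space (QI J). selects J I \<omega> \<and> C (violation (\<omega> ` I))}
    = (\<integral>\<omega>. of_bool (all_support I \<omega>) * of_bool (C (violation (\<omega> ` I)))
        * (1 - violation (\<omega> ` I)) ^ (card J - card I) \<partial>QI I)" (is "measure _ ?Z = (\<integral>\<omega>. ?F \<omega> \<partial>_)")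
proof -
  have fI: "finite I" using J finite_subset by auto
  define K where "K = J - I"
  have K: "finite K" "I \<inter> K = {}" "I \<union> K = J" "card K = card J - card I"
    using J fI by (auto simp: K_def card_Diff_subset)
  have Z: "?Z \<in> sets (QI (I \<union> K))" unfolding K(3) by (rule selects_sets[OF J C])
  have F_meas: "?F \<in> borel_measurable (QI I)"
  proof -
    note [measurable] = violation_measurable[OF fI] C all_support_sets[OF fI order_refl]
    show ?thesis by measurable
  qed
  have "emeasure (QI (I \<union> K)) ?Z = (\<integral>\<^sup>+\<omega>. indicator ?Z \<omega> \<partial>QI (I \<union> K))"
    using Z by simp
  also have "\<dots> = (\<integral>\<^sup>+x. \<integral>\<^sup>+y. indicator ?Z (merge I K (x, y)) \<partial>QI K \<partial>QI I)"
    using Z by (intro P.product_nn_integral_fold K fI borel_measurable_indicator)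
  also have "\<dots> = (\<integral>\<^sup>+x. ennreal (?F x) \<partial>QI I)"
  proof (rule nn_integral_cong)
    fix x assume x: "x \<in> space (QI I)"
    let ?Y = "{y \<in> space (QI K). \<forall>j\<in>K. \<not> violated (x ` I) (y j)}"
    have im: "merge I K (x, y) ` I' = x ` I'" if "I' \<subseteq> I" for I' and y :: "nat \<Rightarrow> 's"
      using that by (auto simp: merge_def image_iff intro!: bexI)
    have as: "all_support I (merge I K (x, y)) \<longleftrightarrow> all_support I x" for y :: "nat \<Rightarrow> 's"
    proof -
      have "merge I K (x, y) ` (I - {j}) = x ` (I - {j})" for j by (rule im) auto
      then show ?thesis unfolding all_support_def by (simp only: im[OF order_refl])
    qed
    have ind: "indicator ?Z (merge I K (x, y)) = (of_bool (all_support I x \<and> C (violation (x ` I))) * indicator ?Y y :: ennreal)"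
      if y: "y \<in> space (QI K)" for y
    proof -
      have "merge I K (x, y) \<in> space (QI J)"
        using x y K(3) by (auto simp: space_PiM PiE_iff merge_def extensional_def)
      moreover have "(\<forall>j\<in>J-I. \<not> violated (x ` I) (merge I K (x, y) j)) \<longleftrightarrow> (\<forall>j\<in>K. \<not> violated (x ` I) (y j))"
        using K(2) unfolding K_def by (auto simp: merge_def)
      ultimately have "merge I K (x, y) \<in> ?Z \<longleftrightarrow> all_support I x \<and> C (violation (x ` I)) \<and> y \<in> ?Y"
        using y by (simp only: selects_def mem_Collect_eq im[OF order_refl] as simp_thms conj_commute conj_left_commute)
      then show ?thesis by (auto simp: indicator_def)
    qed
    have Y: "?Y \<in> sets (QI K)"
    proof -
      have "{s \<in> space Q. \<not> violated (x ` I) s} = space Q - {s \<in> space Q. violated (x ` I) s}" by auto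
      then have "{s \<in> space Q. \<not> violated (x ` I) s} \<in> sets Q"
        using violated_section_sets[OF fI x] by auto
      moreover have "?Y = Pi\<^sub>E K (\<lambda>_. {s \<in> space Q. \<not> violated (x ` I) s})"
        by (auto simp: space_PiM PiE_iff extensional_def)
      ultimately show ?thesis using K(1) by auto
    qed
    have "(\<integral>\<^sup>+y. indicator ?Z (merge I K (x, y)) \<partial>QI K)
        = (\<integral>\<^sup>+y. of_bool (all_support I x \<and> C (violation (x ` I))) * indicator ?Y y \<partial>QI K)"
      by (rule nn_integral_cong) (rule ind)
    also have "\<dots> = of_bool (all_support I x \<and> C (violation (x ` I))) * emeasure (QI K) ?Y"
      using Y by (simp add: nn_integral_cmult_indicator)
    also have "\<dots> = ennreal (?F x)"
      unfolding prob_not_violated[OF fI x K(1)] K(4) by auto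
    finally show "(\<integral>\<^sup>+y. indicator ?Z (merge I K (x, y)) \<partial>QI K) = ennreal (?F x)" .
  qed
  finally have e: "emeasure (QI J) ?Z = (\<integral>\<^sup>+x. ennreal (?F x) \<partial>QI I)" unfolding K(3) .
  show ?thesis
    unfolding measure_def e
    using violation_bounds by (intro integral_eq_nn_integral[symmetric] F_meas) (auto)
qed

text \<open>Exchangeability: a bijection of index sets preserves the product law, so all subsets of
  size k contribute equally.\<close>

lemma integral_reindex_card:
  assumes I: "finite I" and C: "Measurable.pred borel C"
  shows "(\<integral>\<omega>. of_bool (all_support I \<omega>) * of_bool (C (violation (\<omega> ` I))) * (1 - violation (\<omega> ` I)) ^ m \<partial>QI I)
    = (\<integral>\<omega>. of_bool (all_support {..<card I} \<omega>) * of_bool (C (violation (\<omega> ` {..<card I})))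
        * (1 - violation (\<omega> ` {..<card I})) ^ m \<partial>QI {..<card I})"
proof -
  let ?n = "{..<card I}"
  obtain f where f: "bij_betw f ?n I"
    using ex_bij_betw_nat_finite[OF I] by (auto simp: lessThan_atLeast0)
  let ?t = "\<lambda>\<omega>. \<lambda>n\<in>?n. \<omega> (f n) :: 's"
  have d: "distr (QI I) (QI ?n) ?t = QI ?n"
    using distr_PiM_reindex[of I "\<lambda>_. Q" f ?n] f prob_space_axioms by (auto simp: bij_betw_def)
  have t: "?t \<in> measurable (QI I) (QI ?n)"
    using f by (intro measurable_restrict measurable_component_singleton) (auto simp: bij_betw_def)
  let ?F = "\<lambda>I \<omega>. of_bool (all_support I \<omega>) * of_bool (C (violation (\<omega> ` I))) * (1 - violation (\<omega> ` I)) ^ m :: real"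
  have F_meas: "?F ?n \<in> borel_measurable (QI ?n)"
  proof -
    note [measurable] = violation_measurable[OF finite_lessThan] C all_support_sets[OF finite_lessThan order_refl]
    show ?thesis by measurable
  qed
  have im: "?t \<omega> ` A = \<omega> ` f ` A" if "A \<subseteq> ?n" for \<omega> A
    using that by (auto simp: image_iff intro!: bexI)
  have fI: "f ` ?n = I" using f by (simp add: bij_betw_def)
  have fD: "f ` (?n - {j}) = I - {f j}" if "j < card I" for j
    using that f by (auto simp: bij_betw_def inj_on_def)
  have "all_support ?n (?t \<omega>) \<longleftrightarrow> all_support I \<omega>" for \<omega>
  proof -
    have "all_support ?n (?t \<omega>) \<longleftrightarrow> (\<forall>j\<in>?n. w (\<omega> ` (I - {f j})) < w (\<omega> ` I))"
      unfolding all_support_def by (simp add: im fI fD del: restrict_apply image_restrict_eq)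
    also have "\<dots> \<longleftrightarrow> (\<forall>i\<in>f ` ?n. w (\<omega> ` (I - {i})) < w (\<omega> ` I))" by simp
    finally show ?thesis by (simp add: fI all_support_def)
  qed
  moreover have "?t \<omega> ` ?n = \<omega> ` I" for \<omega> using im[of ?n \<omega>] fI by simp
  ultimately have "?F ?n (?t \<omega>) = ?F I \<omega>" for \<omega> by presburger
  then have "(\<integral>\<omega>. ?F I \<omega> \<partial>QI I) = (\<integral>\<omega>. ?F ?n (?t \<omega>) \<partial>QI I)" by presburger
  also have "\<dots> = (\<integral>\<omega>. ?F ?n \<omega> \<partial>distr (QI I) (QI ?n) ?t)"
    by (rule integral_distr[symmetric, OF t F_meas])
  finally show ?thesis unfolding d .
qed

text \<open>Total probability over the selected subset. Almost surely it is exactly the support set,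
  whose violation is that of J because the values agree; Helly removes all sizes above z.\<close>

lemma prob_violation_expansion:
  assumes J: "finite J" "z \<le> card J" and C: "Measurable.pred borel C"
  shows "measure (QI J) {\<omega> \<in> space (QI J). C (violation (\<omega> ` J))}
    = (\<Sum>k\<le>z. real (card J choose k) *
        (\<integral>\<omega>. of_bool (all_support {..<k} \<omega>) * of_bool (C (violation (\<omega> ` {..<k})))
          * (1 - violation (\<omega> ` {..<k})) ^ (card J - k) \<partial>QI {..<k}))" (is "measure _ ?E = _")
proof -
  let ?Z = "\<lambda>I. {\<omega> \<in> space (QI J). selects J I \<omega> \<and> C (violation (\<omega> ` I))}"
  interpret J: prob_space "QI J" by (intro prob_space_PiM prob_space_axioms)
  have Z: "?Z I \<in> sets (QI J)" if "I \<in> Pow J" for I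
    using that by (intro selects_sets J C) auto
  have E: "?E \<in> sets (QI J)"
    using measurable_compose[OF violation_measurable[OF J(1)] C] by (simp add: pred_def)
  have "AE \<omega> in QI J. indicator ?E \<omega> = (\<Sum>I\<in>Pow J. indicator (?Z I) \<omega> :: real)"
    using value_nondegenerate[OF J(1)] AE_space
  proof eventually_elim
    case (elim \<omega>)
    have full: "w (\<omega> ` support J \<omega>) = w (\<omega> ` J)" using elim by (simp add: support_def)
    have sub: "support J \<omega> \<subseteq> J" by (auto simp: support_def)
    have "(\<Sum>I\<in>Pow J. indicator (?Z I) \<omega> :: real)
        = (\<Sum>I\<in>Pow J. if I = support J \<omega> then of_bool (C (violation (\<omega> ` I))) else 0)"
      using support_unique[OF J(1) _ full] elim(2) by (intro sum.cong) (auto simp: indicator_def selects_def)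
    also have "\<dots> = of_bool (C (violation (\<omega> ` support J \<omega>)))"
      using J(1) sub by simp
    also have "violation (\<omega> ` support J \<omega>) = violation (\<omega> ` J)"
      using J(1) sub full by (intro violation_cong) auto
    finally show ?case using elim(2) by (simp add: indicator_def)
  qed
  then have "(\<integral>\<omega>. indicator ?E \<omega> \<partial>QI J) = (\<integral>\<omega>. (\<Sum>I\<in>Pow J. indicator (?Z I) \<omega> :: real) \<partial>QI J)"
    using E Z by (intro integral_cong_AE) auto
  also have "\<dots> = (\<Sum>I\<in>Pow J. measure (QI J) (?Z I))"
    using Z by (subst Bochner_Integration.integral_sum) (auto simp: J.emeasure_eq_measure)
  also have "\<dots> = (\<Sum>I\<in>Pow J. (\<integral>\<omega>. of_bool (all_support {..<card I} \<omega>) * of_bool (C (violation (\<omega> ` {..<card I})))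
          * (1 - violation (\<omega> ` {..<card I})) ^ (card J - card I) \<partial>QI {..<card I}))"
  proof (rule sum.cong[OF refl])
    fix I assume "I \<in> Pow J"
    then have I: "I \<subseteq> J" "finite I" using J(1) finite_subset by auto
    show "measure (QI J) (?Z I) = (\<integral>\<omega>. of_bool (all_support {..<card I} \<omega>) * of_bool (C (violation (\<omega> ` {..<card I})))
          * (1 - violation (\<omega> ` {..<card I})) ^ (card J - card I) \<partial>QI {..<card I})"
      unfolding prob_selects[OF J(1) I(1) C] by (rule integral_reindex_card[OF I(2) C])
  qed
  also have "\<dots> = (\<Sum>k\<le>z. real (card J choose k) *
        (\<integral>\<omega>. of_bool (all_support {..<k} \<omega>) * of_bool (C (violation (\<omega> ` {..<k})))
          * (1 - violation (\<omega> ` {..<k})) ^ (card J - k) \<partial>QI {..<k}))"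
  proof (rule sum_Pow_card[OF J])
    fix k assume "z < k"
    then have "\<not> all_support {..<k} \<omega>" for \<omega> using all_support_card[of "{..<k}" \<omega>] by auto
    then show "(\<integral>\<omega>. of_bool (all_support {..<k} \<omega>) * of_bool (C (violation (\<omega> ` {..<k})))
          * (1 - violation (\<omega> ` {..<k})) ^ (card J - k) \<partial>QI {..<k}) = 0" by simp
  qed
  finally show ?thesis using E by simp
qed

text \<open>The support events and violations in the expansion depend on k alone; the sample size
  enters only through binomials and exponents. The true predicate therefore gives a moment identity
  for every size from z on, all about the same variables as the tail.\<close>

theorem prob_violation_tail:
  assumes J: "finite J" "z \<le> card J" and z: "0 < z" and \<epsilon>: "0 < \<epsilon>" "\<epsilon> < 1"
  shows "measure (QI J) {\<omega> \<in> space (QI J). \<epsilon> < violation (\<omega> ` J)} \<le> binomial_cdf z (card J) (1 - \<epsilon>)"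
proof -
  have "measure (QI J) {\<omega> \<in> space (QI J). \<epsilon> < violation (\<omega> ` J)}
    = (\<Sum>k\<le>z. real (card J choose k) *
        (\<integral>\<omega>. of_bool (all_support {..<k} \<omega>) * of_bool (\<epsilon> < violation (\<omega> ` {..<k}))
          * (1 - violation (\<omega> ` {..<k})) ^ (card J - k) \<partial>QI {..<k}))"
    using J by (intro prob_violation_expansion) auto
  also have "\<dots> \<le> binomial_cdf z (card J) (1 - \<epsilon>)"
  proof (rule binomial_moment_tail_bound)
    fix k
    interpret K: prob_space "QI {..<k}" by (intro prob_space_PiM prob_space_axioms)
    show "finite_measure (QI {..<k})" by unfold_locales
    show "(\<lambda>\<omega>. of_bool (all_support {..<k} \<omega>)) \<in> borel_measurable (QI {..<k})"
    proof -
      note [measurable] = all_support_sets[OF finite_lessThan order_refl]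
      show ?thesis by measurable
    qed
    show "(\<lambda>\<omega>. violation (\<omega> ` {..<k})) \<in> borel_measurable (QI {..<k})"
      by (rule violation_measurable) simp
  next
    fix N assume "z \<le> N"
    interpret N: prob_space "QI {..<N}" by (intro prob_space_PiM prob_space_axioms)
    have "1 = measure (QI {..<N}) {\<omega> \<in> space (QI {..<N}). True}" by (simp add: N.prob_space)
    also have "\<dots> = (\<Sum>k\<le>z. real (card {..<N} choose k) *
        (\<integral>\<omega>. of_bool (all_support {..<k} \<omega>) * of_bool True
          * (1 - violation (\<omega> ` {..<k})) ^ (card {..<N} - k) \<partial>QI {..<k}))"
      using \<open>z \<le> N\<close> by (intro prob_violation_expansion) auto
    finally show "(\<Sum>k\<le>z. real (N choose k) * (\<integral>\<omega>. of_bool (all_support {..<k} \<omega>)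
          * (1 - violation (\<omega> ` {..<k})) ^ (N - k) \<partial>QI {..<k})) = 1" by simp
  qed (use violation_bounds assms in auto)
  finally show ?thesis .
qed

end

subsection \<open>Randomly relaxed programs\<close>

text \<open>Stated for a family, since distinct constraints may produce the same vector; such a
  coincidence gives the coefficients 1 and -1.\<close>

lemma linear_relation_exists:
  fixes U :: "'a \<Rightarrow> 'b::euclidean_space"
  assumes A: "finite A" "DIM('b) < card A"
  shows "\<exists>\<alpha>. (\<exists>a\<in>A. \<alpha> a \<noteq> 0) \<and> (\<Sum>a\<in>A. \<alpha> a *\<^sub>R U a) = 0"
proof (cases "inj_on U A")
  case True
  then have "dependent (U ` A)"
    using A by (intro dependent_biggerset) (auto simp: card_image)
  then obtain \<beta> where \<beta>: "\<exists>b\<in>U ` A. \<beta> b \<noteq> 0" "(\<Sum>b\<in>U ` A. \<beta> b *\<^sub>R b) = 0"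
    using dependent_finite[of "U ` A"] A(1) by auto
  then have "(\<Sum>a\<in>A. \<beta> (U a) *\<^sub>R U a) = 0"
    using sum.reindex[OF True, of "\<lambda>b. \<beta> b *\<^sub>R b"] by simp
  then show ?thesis using \<beta>(1) by (intro exI[of _ "\<lambda>a. \<beta> (U a)"]) auto
next
  case False
  then obtain a b where ab: "a \<in> A" "b \<in> A" "a \<noteq> b" "U a = U b" by (auto simp: inj_on_def)
  let ?\<alpha> = "\<lambda>c. if c = a then 1 else if c = b then - 1 else 0 :: real"
  have "(\<Sum>c\<in>A. ?\<alpha> c *\<^sub>R U c) = (\<Sum>c\<in>{a, b}. ?\<alpha> c *\<^sub>R U c)"
    using A(1) ab by (intro sum.mono_neutral_right) auto
  also have "\<dots> = 0" using ab by simp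
  finally show ?thesis using ab(1) by (intro exI[of _ ?\<alpha>]) auto
qed

text \<open>
  A constraint is a pair \<open>(\<delta>, \<tau>)\<close> of a sample and a random label which relaxes the right-hand side.
  The constant \<open>K\<close> is the value of infeasible programs.
\<close>

locale labelled_scenario =
  fixes X :: "'x::euclidean_space set" and f :: "'x \<Rightarrow> real" and u :: "'r::finite \<Rightarrow> 'x \<Rightarrow> 'e::euclidean_space"
    and v :: "'d \<Rightarrow> 'e" and \<rho> :: real and K :: real
  assumes X: "compact X" "convex X"
    and f_cont: "continuous_on X f"
    and f_strict: "\<And>x y \<mu>. x \<in> X \<Longrightarrow> y \<in> X \<Longrightarrow> x \<noteq> y \<Longrightarrow> 0 < \<mu> \<Longrightarrow> \<mu> < 1 \<Longrightarrow>
      f ((1 - \<mu>) *\<^sub>R x + \<mu> *\<^sub>R y) < (1 - \<mu>) * f x + \<mu> * f y"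
    and f_less: "\<And>x. x \<in> X \<Longrightarrow> f x < K"
    and row_convex: "\<And>i \<delta>. convex_on X (\<lambda>x. u i x \<bullet> v \<delta>)"
    and row_cont: "\<And>i \<delta>. continuous_on X (\<lambda>x. u i x \<bullet> v \<delta>)"
    and rho: "0 < \<rho>"
begin

definition satisfies :: "'x \<Rightarrow> 'd \<times> real \<Rightarrow> bool" where
  "satisfies x s \<longleftrightarrow> (\<forall>i. u i x \<bullet> v (fst s) \<le> \<rho> * \<bar>snd s\<bar>)"

definition feasible :: "('d \<times> real) set \<Rightarrow> 'x set" where
  "feasible A = {x \<in> X. \<forall>s\<in>A. satisfies x s}"

definition opt_value :: "('d \<times> real) set \<Rightarrow> real" where
  "opt_value A = Inf (insert K (f ` feasible A))"

lemma feasible_subset: "feasible A \<subseteq> X" by (auto simp: feasible_def)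

lemma bdd_below_values: "bdd_below (insert K (f ` feasible A))"
proof -
  have "bounded (f ` X)" by (intro compact_imp_bounded compact_continuous_image f_cont X)
  then have "bdd_below (f ` X)" by (rule bounded_imp_bdd_below)
  then have "bdd_below (f ` feasible A)" by (rule bdd_below_mono) (use feasible_subset in auto)
  then show ?thesis by simp
qed

lemma opt_value_le: "x \<in> feasible A \<Longrightarrow> opt_value A \<le> f x"
  unfolding opt_value_def by (intro cInf_lower bdd_below_values) auto

lemma opt_value_le_K: "opt_value A \<le> K"
  unfolding opt_value_def by (intro cInf_lower bdd_below_values) auto

lemma opt_value_mono: "A \<subseteq> B \<Longrightarrow> opt_value A \<le> opt_value B"
  unfolding opt_value_def by (intro cInf_superset_mono bdd_below_values) (auto simp: feasible_def)

lemma convex_feasible: "convex (feasible A)"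
  unfolding convex_alt
proof (intro ballI allI impI)
  fix x y \<mu> assume xy: "x \<in> feasible A" "y \<in> feasible A" and \<mu>: "0 \<le> \<mu> \<and> \<mu> \<le> (1::real)"
  let ?z = "(1 - \<mu>) *\<^sub>R x + \<mu> *\<^sub>R y"
  have zX: "?z \<in> X" using X(2) xy \<mu> by (auto simp: convex_alt feasible_def)
  have "u i ?z \<bullet> v (fst s) \<le> \<rho> * \<bar>snd s\<bar>" if s: "s \<in> A" for i s
  proof -
    have "u i ?z \<bullet> v (fst s) \<le> (1 - \<mu>) * (u i x \<bullet> v (fst s)) + \<mu> * (u i y \<bullet> v (fst s))"
      using convex_onD[OF row_convex] xy \<mu> by (auto simp: feasible_def)
    also have "\<dots> \<le> (1 - \<mu>) * (\<rho> * \<bar>snd s\<bar>) + \<mu> * (\<rho> * \<bar>snd s\<bar>)"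
      using xy \<mu> s by (intro add_mono mult_left_mono) (auto simp: feasible_def satisfies_def)
    finally show ?thesis by (simp add: algebra_simps)
  qed
  then show "?z \<in> feasible A" using zX by (auto simp: feasible_def satisfies_def)
qed

lemma compact_feasible: "compact (feasible A)"
proof -
  have "feasible A = X \<inter> (\<Inter>s\<in>A. \<Inter>i. {x \<in> X. u i x \<bullet> v (fst s) \<le> \<rho> * \<bar>snd s\<bar>})"
    by (auto simp: feasible_def satisfies_def)
  moreover have "closed {x \<in> X. u i x \<bullet> v (fst s) \<le> \<rho> * \<bar>snd s\<bar>}" for i and s :: "'d \<times> real"
    by (intro continuous_on_closed_Collect_le row_cont continuous_on_const compact_imp_closed X)
  ultimately show ?thesis
    using X(1) by (auto intro!: compact_Int_closed closed_INT)
qed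

lemma opt_value_attained:
  assumes "opt_value A < K"
  obtains x where "x \<in> feasible A" "f x = opt_value A"
proof -
  have "feasible A \<noteq> {}"
    using assms by (auto simp: opt_value_def)
  then obtain x where x: "x \<in> feasible A" "\<And>y. y \<in> feasible A \<Longrightarrow> f x \<le> f y"
    using continuous_attains_inf[OF compact_feasible, of A f] continuous_on_subset[OF f_cont feasible_subset]
    by blast
  have "f x \<le> opt_value A"
    unfolding opt_value_def using x f_less[of x] feasible_subset[of A] by (intro cInf_greatest) (auto intro: less_imp_le)
  then show thesis using that[OF x(1)] opt_value_le[OF x(1)] by simp
qed

lemma f_convex: "convex_on X f"
proof (rule convex_onI[OF _ X(2)])
  fix \<mu> x y assume "0 < \<mu>" "\<mu> < (1::real)" "x \<in> X" "y \<in> X"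
  then show "f ((1 - \<mu>) *\<^sub>R x + \<mu> *\<^sub>R y) \<le> (1 - \<mu>) * f x + \<mu> * f y"
    using f_strict[of x y \<mu>] by (cases "x = y") (auto simp: algebra_simps)
qed

lemma optimizer_unique:
  assumes "x \<in> feasible A" "f x = opt_value A" "y \<in> feasible A" "f y = opt_value A"
  shows "x = y"
proof (rule ccontr)
  assume "x \<noteq> y"
  then have "f ((1 - 1/2) *\<^sub>R x + (1/2) *\<^sub>R y) < (1 - 1/2) * f x + (1/2) * f y"
    using assms feasible_subset by (intro f_strict) auto
  moreover have "(1 - 1/2) *\<^sub>R x + (1/2) *\<^sub>R y \<in> feasible A"
    using convexD_alt[OF convex_feasible[of A] assms(1,3), of "1/2"] by simp
  ultimately show False
    using opt_value_le[of "(1 - 1/2) *\<^sub>R x + (1/2) *\<^sub>R y" A] assms by simp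
qed

text \<open>By uniqueness, an unchanged value means an unchanged optimiser. This lets violation be
  expressed through values alone.\<close>

lemma opt_value_insert_eq:
  assumes x: "x \<in> feasible A" "f x = opt_value A"
  shows "opt_value (insert s A) = opt_value A \<longleftrightarrow> satisfies x s"
proof
  assume eq: "opt_value (insert s A) = opt_value A"
  have "opt_value (insert s A) < K" unfolding eq x(2)[symmetric] using x(1) feasible_subset f_less by auto
  then obtain y where y: "y \<in> feasible (insert s A)" "f y = opt_value (insert s A)"
    by (rule opt_value_attained)
  then have "x = y" using x eq by (intro optimizer_unique[of x A y]) (auto simp: feasible_def)
  then show "satisfies x s" using y(1) by (simp add: feasible_def)
next
  assume "satisfies x s"
  then have "x \<in> feasible (insert s A)" using x(1) by (auto simp: feasible_def)
  then show "opt_value (insert s A) = opt_value A"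
    using opt_value_le[of x "insert s A"] opt_value_mono[OF subset_insertI[of A s]] x(2) by simp
qed

text \<open>The unique optimiser for A satisfies each member of B separately, hence all of B; an
  infeasible A already has the largest value K.\<close>

lemma opt_value_local:
  assumes eq: "\<And>s. s \<in> B \<Longrightarrow> opt_value (insert s A) = opt_value A"
  shows "opt_value (A \<union> B) = opt_value A"
proof (rule antisym)
  show "opt_value A \<le> opt_value (A \<union> B)" by (rule opt_value_mono) auto
  show "opt_value (A \<union> B) \<le> opt_value A"
  proof (cases "opt_value A < K")
    case True
    then obtain x where x: "x \<in> feasible A" "f x = opt_value A" by (rule opt_value_attained)
    then have "satisfies x s" if "s \<in> B" for s
      using opt_value_insert_eq[OF x] eq that by auto
    then have "x \<in> feasible (A \<union> B)" using x(1) by (auto simp: feasible_def)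
    then show ?thesis using opt_value_le x(2) by metis
  next
    case False
    then show ?thesis using opt_value_le_K[of "A \<union> B"] by simp
  qed
qed

text \<open>
  A Radon-type argument: if removing any constraint \<open>a\<close> admitted a better point \<open>x a\<close>, then a linear
  relation between the vectors \<open>(u i (x a))\<^sub>i\<close>, restricted to its positive coefficients, would
  give a feasible convex combination. The constant terms \<open>\<rho> * \<bar>\<tau>\<bar>\<close> cost no extra dimension because
  they are nonnegative and the sign of the relation is free.
\<close>

lemma opt_value_helly:
  assumes A: "finite A" "CARD('r) * DIM('e) < card A"
  shows "\<exists>a\<in>A. opt_value (A - {a}) = opt_value A"
proof (rule ccontr)
  assume "\<not> ?thesis"
  then have "opt_value (A - {a}) < opt_value A" if "a \<in> A" for a
    using opt_value_mono[of "A - {a}" A] that by (auto simp: less_le)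
  then have "\<exists>x. x \<in> feasible (A - {a}) \<and> f x < opt_value A" if "a \<in> A" for a
    using opt_value_attained[of "A - {a}"] opt_value_le_K[of A] that by (metis order_less_le_trans)
  then obtain x where x: "\<And>a. a \<in> A \<Longrightarrow> x a \<in> feasible (A - {a})" "\<And>a. a \<in> A \<Longrightarrow> f (x a) < opt_value A"
    by metis
  have xX: "x a \<in> X" if "a \<in> A" for a using x(1)[OF that] by (simp add: feasible_def)
  obtain \<alpha>' where \<alpha>': "\<exists>a\<in>A. \<alpha>' a \<noteq> 0" "(\<Sum>a\<in>A. \<alpha>' a *\<^sub>R (\<chi> i. u i (x a))) = 0"
    using linear_relation_exists[of A "\<lambda>a. \<chi> i. u i (x a)"] A by auto
  \<comment> \<open>The sign is chosen to make the total coefficient nonnegative. Hence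
    \<open>sum n A \<le> sum p A\<close>, which later absorbs the nonnegative right-hand
    side.\<close>
  define \<alpha> where "\<alpha> a = (if 0 \<le> sum \<alpha>' A then \<alpha>' a else - \<alpha>' a)" for a
  have \<alpha>_nz: "\<exists>a\<in>A. \<alpha> a \<noteq> 0" using \<alpha>'(1) by (auto simp: \<alpha>_def)
  have \<alpha>_sum: "0 \<le> sum \<alpha> A"
    unfolding \<alpha>_def by (cases "0 \<le> sum \<alpha>' A") (simp_all add: sum_negf)
  have "(\<Sum>a\<in>A. \<alpha> a *\<^sub>R (\<chi> i. u i (x a))) = 0"
    using \<alpha>'(2) unfolding \<alpha>_def by (cases "0 \<le> sum \<alpha>' A") (simp_all add: sum_negf)
  then have rel: "(\<Sum>a\<in>A. \<alpha> a *\<^sub>R u i (x a)) = 0" for i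
    by (auto simp: vec_eq_iff)
  define p where "p a = max 0 (\<alpha> a)" for a
  define n where "n a = max 0 (- \<alpha> a)" for a
  have pn: "\<alpha> a = p a - n a" "0 \<le> p a" "0 \<le> n a" for a by (auto simp: p_def n_def)
  have np_sum: "sum n A \<le> sum p A" using \<alpha>_sum by (simp add: pn(1) sum_subtractf)
  define tot where "tot = sum p A"
  have tot: "0 < tot"
  proof (rule ccontr)
    assume "\<not> 0 < tot"
    then have "sum p A = 0" "sum n A = 0"
      using np_sum sum_nonneg[of A p] sum_nonneg[of A n] pn by (auto simp: tot_def)
    then have "\<forall>a\<in>A. p a = 0 \<and> n a = 0"
      using sum_nonneg_eq_0_iff[OF A(1), of p] sum_nonneg_eq_0_iff[OF A(1), of n] pn by auto
    then show False using \<alpha>_nz pn(1) by auto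
  qed
  have A_ne: "A \<noteq> {}" using \<alpha>_nz by auto
  define y where "y = (\<Sum>a\<in>A. (p a / tot) *\<^sub>R x a)"
  have weights: "(\<Sum>a\<in>A. p a / tot) = 1" "\<And>a. 0 \<le> p a / tot"
    using tot pn(2) by (auto simp: sum_divide_distrib[symmetric] tot_def)
  have yX: "y \<in> X"
    unfolding y_def using weights xX by (intro convex_sum A X) auto
  have "satisfies y s" if s: "s \<in> A" for s
    unfolding satisfies_def
  proof
    fix i
    let ?h = "\<lambda>a. u i (x a) \<bullet> v (fst s)" and ?t = "\<rho> * \<bar>snd s\<bar>"
    have t: "0 \<le> ?t" using rho by simp
    have off: "?h a \<le> ?t" if "a \<in> A" "a \<noteq> s" for a
      using x(1)[OF that(1)] that(2) s by (auto simp: feasible_def satisfies_def)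
    have "(\<Sum>a\<in>A. p a * ?h a) \<le> tot * ?t"
    \<comment> \<open>Only x s may violate s, and its weight vanishes in p or in n. If it vanishes
      in n, the linear relation first exchanges p for n.\<close>
    proof (cases "0 < \<alpha> s")
      case False
      then have "p s = 0" by (simp add: p_def)
      then have "(\<Sum>a\<in>A. p a * ?h a) \<le> (\<Sum>a\<in>A. p a * ?t)"
        using off pn(2) by (intro sum_mono) (metis mult_eq_0_iff mult_left_mono order_refl)
      then show ?thesis by (simp add: tot_def sum_distrib_right)
    next
      case True
      then have "n s = 0" by (simp add: n_def)
      have "(\<Sum>a\<in>A. \<alpha> a *\<^sub>R u i (x a)) \<bullet> v (fst s) = 0" by (simp add: rel)
      then have "(\<Sum>a\<in>A. p a * ?h a) = (\<Sum>a\<in>A. n a * ?h a)"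
        by (simp add: inner_sum_left pn(1) left_diff_distrib sum_subtractf)
      also have "\<dots> \<le> (\<Sum>a\<in>A. n a * ?t)"
        using off pn(3) \<open>n s = 0\<close> by (intro sum_mono) (metis mult_eq_0_iff mult_left_mono order_refl)
      also have "\<dots> \<le> tot * ?t"
        unfolding sum_distrib_right[symmetric] tot_def by (intro mult_right_mono np_sum t)
      finally show ?thesis .
    qed
    have "u i y \<bullet> v (fst s) \<le> (\<Sum>a\<in>A. p a / tot * ?h a)"
      unfolding y_def using weights xX by (intro convex_on_sum[OF A(1) A_ne row_convex]) auto
    also have "\<dots> = (\<Sum>a\<in>A. p a * ?h a) / tot" by (simp add: sum_divide_distrib)
    also have "\<dots> \<le> ?t"
      using \<open>(\<Sum>a\<in>A. p a * ?h a) \<le> tot * ?t\<close> tot by (simp add: field_simps)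
    finally show "u i y \<bullet> v (fst s) \<le> ?t" .
  qed
  then have "opt_value A \<le> f y" using yX by (intro opt_value_le) (auto simp: feasible_def)
  also have "f y \<le> (\<Sum>a\<in>A. p a / tot * f (x a))"
    unfolding y_def using weights xX by (intro convex_on_sum[OF A(1) A_ne f_convex]) auto
  also have "\<dots> < (\<Sum>a\<in>A. p a / tot * opt_value A)"
  proof (rule sum_strict_mono_ex1[OF A(1)])
    show "\<forall>a\<in>A. p a / tot * f (x a) \<le> p a / tot * opt_value A"
    proof
      fix a assume "a \<in> A"
      then show "p a / tot * f (x a) \<le> p a / tot * opt_value A"
        using mult_left_mono[OF less_imp_le[OF x(2)] weights(2)] by blast
    qed
    obtain a where "a \<in> A" "p a \<noteq> 0" using tot unfolding tot_def by (metis less_irrefl sum.neutral)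
    then show "\<exists>a\<in>A. p a / tot * f (x a) < p a / tot * opt_value A"
      using pn(2)[of a] tot x(2) by (intro bexI[of _ a] mult_strict_left_mono) auto
  qed
  also have "\<dots> = opt_value A"
    unfolding sum_distrib_right[symmetric] weights(1) by simp
  finally show False by simp
qed

text \<open>
  By convexity, the optimal value strictly decreases in the label of a constraint as long as it
  exceeds the value without that constraint.
\<close>

lemma opt_value_label_inj:
  assumes less: "\<bar>\<tau>\<bar> < \<bar>\<tau>'\<bar>" and eq: "opt_value (insert (\<delta>, \<tau>) A) = opt_value (insert (\<delta>, \<tau>') A)"
    and lt: "opt_value (insert (\<delta>, \<tau>) A) < K"
  shows "opt_value (insert (\<delta>, \<tau>) A) \<le> opt_value A"
proof (rule ccontr)
  let ?a = "opt_value (insert (\<delta>, \<tau>) A)"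
  assume "\<not> ?thesis"
  then have A_lt: "opt_value A < ?a" by simp
  obtain x where x: "x \<in> feasible (insert (\<delta>, \<tau>) A)" "f x = ?a"
    using opt_value_attained[OF lt] by blast
  obtain y where y: "y \<in> feasible A" "f y = opt_value A"
    using opt_value_attained[of A] A_lt lt by force
  define m where "m = Max (range (\<lambda>i. u i y \<bullet> v \<delta>))"
  have m: "u i y \<bullet> v \<delta> \<le> m" for i unfolding m_def by (intro Max_ge) auto
  define \<theta> where "\<theta> = \<rho> * \<bar>\<tau>'\<bar> - \<rho> * \<bar>\<tau>\<bar>"
  have \<theta>: "0 < \<theta>" using less rho by (simp add: \<theta>_def)
  \<comment> \<open>Moving from x towards y by \<mu> raises the bound on the rows by at most \<mu> *
    (m - \<rho> * \<bar>\<tau>\<bar>), which must fit into the slack \<theta> gained from the larger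
    label. The summand \<theta> in the denominator keeps it positive and \<mu> at most 1.\<close>
  define \<mu> where "\<mu> = \<theta> / (\<theta> + \<bar>m - \<rho> * \<bar>\<tau>\<bar>\<bar>)"
  have \<mu>: "0 < \<mu>" "\<mu> \<le> 1" using \<theta> by (auto simp: \<mu>_def field_simps)
  have \<mu>m: "\<mu> * (m - \<rho> * \<bar>\<tau>\<bar>) \<le> \<theta>"
  proof -
    have "\<mu> * (m - \<rho> * \<bar>\<tau>\<bar>) \<le> \<mu> * (\<theta> + \<bar>m - \<rho> * \<bar>\<tau>\<bar>\<bar>)" using \<mu> \<theta> by (intro mult_left_mono) auto
    also have "\<dots> = \<theta>" using \<theta> by (simp add: \<mu>_def)
    finally show ?thesis .
  qed
  let ?z = "(1 - \<mu>) *\<^sub>R x + \<mu> *\<^sub>R y"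
  have "?z \<in> feasible A"
    using convex_feasible[of A] x(1) y(1) \<mu> unfolding convex_alt by (auto simp: feasible_def)
  moreover have "u i ?z \<bullet> v \<delta> \<le> \<rho> * \<bar>\<tau>'\<bar>" for i
  proof -
    have "u i ?z \<bullet> v \<delta> \<le> (1 - \<mu>) * (u i x \<bullet> v \<delta>) + \<mu> * (u i y \<bullet> v \<delta>)"
      using convex_onD[OF row_convex] x(1) y(1) \<mu> by (auto simp: feasible_def)
    also have "\<dots> \<le> (1 - \<mu>) * (\<rho> * \<bar>\<tau>\<bar>) + \<mu> * m"
      using x(1) m \<mu> by (intro add_mono mult_left_mono) (auto simp: feasible_def satisfies_def)
    also have "\<dots> \<le> \<rho> * \<bar>\<tau>'\<bar>" using \<mu>m by (simp add: \<theta>_def algebra_simps)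
    finally show ?thesis .
  qed
  ultimately have "?z \<in> feasible (insert (\<delta>, \<tau>') A)" by (auto simp: feasible_def satisfies_def)
  then have "?a \<le> f ?z" unfolding eq by (rule opt_value_le)
  also have "f ?z \<le> (1 - \<mu>) * f x + \<mu> * f y"
    using convex_onD[OF f_convex] x(1) y(1) \<mu> by (auto simp: feasible_def)
  also have "\<dots> = ?a + \<mu> * (opt_value A - ?a)" by (simp add: x(2) y(2) algebra_simps)
  also have "\<dots> < ?a" using \<mu>(1) A_lt by (simp add: mult_pos_neg)
  finally show False by simp
qed

text \<open>For measurability, the search over X is reduced to a countable dense set by loosening
  objective and constraints by 1 / Suc k; compactness recovers a feasible point in the limit. As a <
  K, a value of at most a comes from an actual feasible point.\<close>

lemma opt_value_le_iff_countable:
  assumes D: "D \<subseteq> X" "X \<subseteq> closure D" and a: "a < K" and A: "finite A"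
  shows "opt_value A \<le> a \<longleftrightarrow> (\<forall>k::nat. \<exists>x\<in>D. f x < a + 1 / Suc k \<and>
    (\<forall>s\<in>A. \<forall>i. u i x \<bullet> v (fst s) < \<rho> * \<bar>snd s\<bar> + 1 / Suc k))" (is "_ \<longleftrightarrow> ?R")
proof
  assume "opt_value A \<le> a"
  then obtain x where x: "x \<in> feasible A" "f x = opt_value A" using opt_value_attained[of A] a by force
  then have xX: "x \<in> X" by (simp add: feasible_def)
  then obtain d where d: "\<And>n. d n \<in> D" "d \<longlonglongrightarrow> x"
    using D(2) closure_sequential[of x D] by blast
  have dX: "\<And>n. d n \<in> X" using d(1) D(1) by auto
  have lim_f: "(\<lambda>n. f (d n)) \<longlonglongrightarrow> f x"
    using f_cont xX dX d(2) unfolding continuous_on_sequentially comp_def by blast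
  have lim_row: "(\<lambda>n. u i (d n) \<bullet> v \<delta>) \<longlonglongrightarrow> u i x \<bullet> v \<delta>" for i \<delta>
    using row_cont[of i \<delta>] xX dX d(2) unfolding continuous_on_sequentially comp_def by blast
  show ?R
  proof
    fix k :: nat
    have "f x < a + 1 / Suc k" using x(2) \<open>opt_value A \<le> a\<close> by (simp add: add_le_less_mono[of _ a 0, simplified])
    then have "\<forall>\<^sub>F n in sequentially. f (d n) < a + 1 / Suc k" by (rule order_tendstoD(2)[OF lim_f])
    moreover have "\<forall>\<^sub>F n in sequentially. \<forall>s\<in>A. \<forall>i. u i (d n) \<bullet> v (fst s) < \<rho> * \<bar>snd s\<bar> + 1 / Suc k"
    proof (intro eventually_ball_finite A ballI eventually_all_finite)
      fix s i assume "s \<in> A"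
      then have "u i x \<bullet> v (fst s) \<le> \<rho> * \<bar>snd s\<bar>" using x(1) by (auto simp: feasible_def satisfies_def)
      moreover have "0 < 1 / real (Suc k)" by simp
      ultimately have "u i x \<bullet> v (fst s) < \<rho> * \<bar>snd s\<bar> + 1 / Suc k" by linarith
      then show "\<forall>\<^sub>F n in sequentially. u i (d n) \<bullet> v (fst s) < \<rho> * \<bar>snd s\<bar> + 1 / Suc k"
        by (rule order_tendstoD(2)[OF lim_row])
    qed
    ultimately have "\<forall>\<^sub>F n in sequentially. f (d n) < a + 1 / Suc k \<and>
        (\<forall>s\<in>A. \<forall>i. u i (d n) \<bullet> v (fst s) < \<rho> * \<bar>snd s\<bar> + 1 / Suc k)"
      by (rule eventually_conj)
    from eventually_happens'[OF sequentially_bot this] obtain n where "f (d n) < a + 1 / Suc k \<and>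
        (\<forall>s\<in>A. \<forall>i. u i (d n) \<bullet> v (fst s) < \<rho> * \<bar>snd s\<bar> + 1 / Suc k)" ..
    then show "\<exists>x\<in>D. f x < a + 1 / Suc k \<and> (\<forall>s\<in>A. \<forall>i. u i x \<bullet> v (fst s) < \<rho> * \<bar>snd s\<bar> + 1 / Suc k)"
      using d(1)[of n] by (rule bexI)
  qed
next
  assume ?R
  then obtain d where d: "\<And>k. d k \<in> D" "\<And>k. f (d k) < a + 1 / Suc k"
    "\<And>k s i. s \<in> A \<Longrightarrow> u i (d k) \<bullet> v (fst s) < \<rho> * \<bar>snd s\<bar> + 1 / Suc k"
    by metis
  obtain x r where x: "x \<in> X" "strict_mono (r :: nat \<Rightarrow> nat)" "(d \<circ> r) \<longlonglongrightarrow> x"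
    using X(1) d(1) D(1) unfolding compact_eq_seq_compact_metric seq_compact_def by blast
  have dX: "\<And>n. d (r n) \<in> X" using d(1) D(1) by auto
  have lim_on: "(\<lambda>n. h (d (r n))) \<longlonglongrightarrow> h x" if "continuous_on X h" for h :: "'x \<Rightarrow> real"
    using that[unfolded continuous_on_sequentially, rule_format, OF x(1), of "d \<circ> r"] x(3) dX
    by (simp add: comp_def)
  note lim_f = lim_on[OF f_cont] and lim_row = lim_on[OF row_cont]
  have lim: "(\<lambda>n. b + 1 / Suc (r n)) \<longlonglongrightarrow> b" for b :: real
  proof -
    have "(\<lambda>n. 1 / real (Suc n)) \<longlonglongrightarrow> 0" by (rule LIMSEQ_Suc[OF lim_1_over_n])
    from LIMSEQ_subseq_LIMSEQ[OF this x(2)] have "(\<lambda>n. 1 / real (Suc (r n))) \<longlonglongrightarrow> 0"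
      by (simp add: comp_def)
    from tendsto_add[OF tendsto_const[of b] this] show ?thesis by simp
  qed
  have "u i x \<bullet> v (fst s) \<le> \<rho> * \<bar>snd s\<bar>" if "s \<in> A" for i s
    by (rule LIMSEQ_le[OF lim_row lim]) (use d(3)[OF that] in \<open>auto intro: less_imp_le\<close>)
  then have "x \<in> feasible A" using x(1) by (auto simp: feasible_def satisfies_def)
  then have "opt_value A \<le> f x" by (rule opt_value_le)
  also have "f x \<le> a"
    by (rule LIMSEQ_le[OF lim_f lim]) (use d(2) in \<open>auto intro: less_imp_le\<close>)
  finally show "opt_value A \<le> a" .
qed

lemma opt_value_measurable:
  assumes row_meas: "\<And>x i. x \<in> X \<Longrightarrow> (\<lambda>\<delta>. u i x \<bullet> v \<delta>) \<in> borel_measurable P"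
    and U: "sets U = sets borel"
    and I: "finite (J :: nat set)" "I \<subseteq> J"
  shows "(\<lambda>\<omega>. opt_value (\<omega> ` I)) \<in> borel_measurable (Pi\<^sub>M J (\<lambda>_. P \<Otimes>\<^sub>M U))"
  unfolding borel_measurable_iff_le
proof
  let ?M = "Pi\<^sub>M J (\<lambda>_. P \<Otimes>\<^sub>M U)"
  fix a
  show "{\<omega> \<in> space ?M. opt_value (\<omega> ` I) \<le> a} \<in> sets ?M"
  proof (cases "a < K")
    case False
    then have "opt_value (\<omega> ` I) \<le> a" for \<omega> using opt_value_le_K[of "\<omega> ` I"] by simp
    then show ?thesis by simp
  next
    case True
    have fI: "finite I" using I finite_subset by auto
    obtain D where D: "countable D" "D \<subseteq> X" "X \<subseteq> closure D" by (rule separable)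
    have abs_meas: "(\<lambda>\<tau>. \<rho> * \<bar>\<tau>\<bar>) \<in> borel_measurable U"
      by (subst measurable_cong_sets[OF U refl]) simp
    have "{\<omega> \<in> space ?M. u i x \<bullet> v (fst (\<omega> j)) < \<rho> * \<bar>snd (\<omega> j)\<bar> + 1 / Suc k} \<in> sets ?M"
      if "j \<in> I" "x \<in> D" for i j x and k :: nat
    proof -
      have [measurable]: "(\<lambda>\<omega>. \<omega> j) \<in> measurable ?M (P \<Otimes>\<^sub>M U)"
        using that(1) I by (intro measurable_component_singleton) auto
      have [measurable]: "(\<lambda>\<omega>. u i x \<bullet> v (fst (\<omega> j))) \<in> borel_measurable ?M"
        by (rule measurable_compose[OF _ row_meas]) (use that(2) D in \<open>auto\<close>)
      have [measurable]: "(\<lambda>\<omega>. \<rho> * \<bar>snd (\<omega> j)\<bar>) \<in> borel_measurable ?M"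
        by (rule measurable_compose[OF _ abs_meas]) auto
      show ?thesis by measurable
    qed
    then have "{\<omega> \<in> space ?M. \<forall>k::nat. \<exists>x\<in>D. f x < a + 1 / Suc k \<and>
        (\<forall>j\<in>I. \<forall>i. u i x \<bullet> v (fst (\<omega> j)) < \<rho> * \<bar>snd (\<omega> j)\<bar> + 1 / Suc k)} \<in> sets ?M"
      using D(1) fI
      by (intro sets.sets_Collect_countable_All sets.sets_Collect_countable_Bex sets.sets_Collect_conj
          sets.sets_Collect_const sets.sets_Collect_finite_All) auto
    also have "{\<omega> \<in> space ?M. \<forall>k::nat. \<exists>x\<in>D. f x < a + 1 / Suc k \<and>
        (\<forall>j\<in>I. \<forall>i. u i x \<bullet> v (fst (\<omega> j)) < \<rho> * \<bar>snd (\<omega> j)\<bar> + 1 / Suc k)}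
      = {\<omega> \<in> space ?M. opt_value (\<omega> ` I) \<le> a}"
      using fI by (subst opt_value_le_iff_countable[OF D(2,3) True]) auto
    finally show ?thesis .
  qed
qed

text \<open>Take a smallest B with the full value. If some j in B were no support constraint, the
  value of B would equal that of J without j; by \<open>generic\<close> this coincidence makes j
  redundant in B, against minimality. So B consists of support constraints.\<close>

lemma opt_value_nondegenerate:
  assumes fin: "finite J"
    and lt: "opt_value (\<omega> ` J) < K"
    and generic: "\<And>j B. j \<in> J \<Longrightarrow> B \<subseteq> J - {j} \<Longrightarrow> opt_value (insert (\<omega> j) (\<omega> ` B)) = opt_value (\<omega> ` (J - {j})) \<Longrightarrow>
      opt_value (insert (\<omega> j) (\<omega> ` B)) < K \<Longrightarrow> opt_value (insert (\<omega> j) (\<omega> ` B)) \<le> opt_value (\<omega> ` B)"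
  shows "opt_value (\<omega> ` {j \<in> J. opt_value (\<omega> ` (J - {j})) < opt_value (\<omega> ` J)}) = opt_value (\<omega> ` J)"
    (is "opt_value (\<omega> ` ?S) = _")
proof -
  obtain B where B: "B \<subseteq> J" "opt_value (\<omega> ` B) = opt_value (\<omega> ` J)"
    and B_min: "\<And>C. C \<subseteq> J \<Longrightarrow> opt_value (\<omega> ` C) = opt_value (\<omega> ` J) \<Longrightarrow> card B \<le> card C"
    using ex_has_least_nat[of "\<lambda>C. C \<subseteq> J \<and> opt_value (\<omega> ` C) = opt_value (\<omega> ` J)" J card] by auto
  have "B \<subseteq> ?S"
  proof (rule subsetI, rule ccontr)
    fix j assume j: "j \<in> B" "j \<notin> ?S"
    then have eq: "opt_value (\<omega> ` (J - {j})) = opt_value (\<omega> ` J)"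
      using B(1) opt_value_mono[of "\<omega> ` (J - {j})" "\<omega> ` J"] by force
    have ins: "insert (\<omega> j) (\<omega> ` (B - {j})) = \<omega> ` B" using j(1) by auto
    have "opt_value (\<omega> ` B) \<le> opt_value (\<omega> ` (B - {j}))"
      using generic[of j "B - {j}"] B j(1) eq lt unfolding ins by auto
    moreover have "opt_value (\<omega> ` (B - {j})) \<le> opt_value (\<omega> ` B)" by (rule opt_value_mono) auto
    ultimately have "card B \<le> card (B - {j})" using B by (intro B_min) auto
    then show False using card_Diff1_less[of B j] finite_subset[OF B(1) fin] j(1) by simp
  qed
  then have "opt_value (\<omega> ` B) \<le> opt_value (\<omega> ` ?S)" by (intro opt_value_mono) auto
  moreover have "opt_value (\<omega> ` ?S) \<le> opt_value (\<omega> ` J)" by (intro opt_value_mono) auto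
  ultimately show ?thesis using B(2) by simp
qed

lemma same_abs_null:
  assumes U: "sets U = sets borel" "\<And>r. emeasure U {r :: real} = 0"
    and T: "T \<in> sets U" "\<And>\<tau> \<tau>'. \<tau> \<in> T \<Longrightarrow> \<tau>' \<in> T \<Longrightarrow> \<bar>\<tau>\<bar> = \<bar>\<tau>'\<bar>"
  shows "emeasure U T = 0"
proof (cases "T = {}")
  case False
  then obtain r where "r \<in> T" by auto
  then have "T \<subseteq> {r} \<union> {- r}" using T(2) by (fastforce simp: abs_eq_iff)
  then have "emeasure U T \<le> emeasure U ({r} \<union> {- r})" using U(1) by (intro emeasure_mono) auto
  also have "\<dots> \<le> emeasure U {r} + emeasure U {- r}" using U(1) by (intro emeasure_subadditive) auto
  finally show ?thesis by (simp add: U(2))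
qed simp

text \<open>The value of J - {j} does not involve sample j. With all but the label of j fixed,
  \<open>opt_value_label_inj\<close> allows the bad coincidence for at most one modulus of the
  label, a null set because \<open>U\<close> has no atoms. Fubini concludes.\<close>

lemma generic_label:
  assumes P: "prob_space P" and U: "prob_space U" "sets U = sets borel" "\<And>r. emeasure U {r} = 0"
    and row_meas: "\<And>x i. x \<in> X \<Longrightarrow> (\<lambda>\<delta>. u i x \<bullet> v \<delta>) \<in> borel_measurable P"
    and J: "finite (J :: nat set)" "j \<in> J" "B \<subseteq> J - {j}"
  shows "AE \<omega> in Pi\<^sub>M J (\<lambda>_. P \<Otimes>\<^sub>M U). opt_value (insert (\<omega> j) (\<omega> ` B)) = opt_value (\<omega> ` (J - {j})) \<longrightarrow>
      opt_value (insert (\<omega> j) (\<omega> ` B)) < K \<longrightarrow> opt_value (insert (\<omega> j) (\<omega> ` B)) \<le> opt_value (\<omega> ` B)"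
proof -
  interpret P: prob_space P by (rule P)
  interpret U: prob_space U by (rule U(1))
  interpret PU: pair_prob_space P U ..
  interpret Q: product_prob_space "\<lambda>_ :: nat. P \<Otimes>\<^sub>M U" ..
  let ?M = "Pi\<^sub>M J (\<lambda>_. P \<Otimes>\<^sub>M U)" and ?M' = "Pi\<^sub>M (J - {j}) (\<lambda>_. P \<Otimes>\<^sub>M U)"
  let ?bad = "{\<omega> \<in> space ?M. opt_value (\<omega> ` insert j B) = opt_value (\<omega> ` (J - {j})) \<and>
      opt_value (\<omega> ` insert j B) < K \<and> opt_value (\<omega> ` B) < opt_value (\<omega> ` insert j B)}"
  have meas: "(\<lambda>\<omega>. opt_value (\<omega> ` I)) \<in> borel_measurable ?M" if "I \<subseteq> J" for I
    by (rule opt_value_measurable[OF row_meas U(2) J(1) that])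
  have "insert j B \<subseteq> J" "J - {j} \<subseteq> J" "B \<subseteq> J" using J by auto
  note meas3 = this[THEN meas]
  have bad: "?bad \<in> sets ?M"
    by (intro sets.sets_Collect_conj borel_measurable_eq borel_measurable_less meas3 borel_measurable_const)
  have ins: "insert j (J - {j}) = J" using J(2) by auto
  have "emeasure ?M ?bad = (\<integral>\<^sup>+\<omega>. indicator ?bad \<omega> \<partial>?M)" using bad by simp
  also have "\<dots> = (\<integral>\<^sup>+x. \<integral>\<^sup>+y. indicator ?bad (x(j := y)) \<partial>(P \<Otimes>\<^sub>M U) \<partial>?M')"
    using Q.product_nn_integral_insert[of "J - {j}" j "indicator ?bad"] J(1) bad unfolding ins by simp
  also have "\<dots> = (\<integral>\<^sup>+x. 0 \<partial>?M')"
  proof (rule nn_integral_cong)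
    fix x assume x: "x \<in> space ?M'"
    have upd: "(\<lambda>y. x(j := y)) \<in> measurable (P \<Otimes>\<^sub>M U) ?M"
    proof -
      have "(\<lambda>y. (\<lambda>(f, y). f(j := y)) (x, y)) \<in> measurable (P \<Otimes>\<^sub>M U) (Pi\<^sub>M (insert j (J - {j})) (\<lambda>_. P \<Otimes>\<^sub>M U))"
        by (rule measurable_compose[OF measurable_Pair1'[OF x] measurable_add_dim])
      then show ?thesis unfolding ins by simp
    qed
    let ?T = "{y \<in> space (P \<Otimes>\<^sub>M U). x(j := y) \<in> ?bad}"
    have T: "?T \<in> sets (P \<Otimes>\<^sub>M U)"
      using measurable_sets[OF upd bad] by (simp add: vimage_def Int_def conj_commute)
    have "(\<integral>\<^sup>+y. indicator ?bad (x(j := y)) \<partial>(P \<Otimes>\<^sub>M U)) = (\<integral>\<^sup>+y. indicator ?T y \<partial>(P \<Otimes>\<^sub>M U))"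
      by (rule nn_integral_cong) (auto simp: indicator_def)
    also have "\<dots> = emeasure (P \<Otimes>\<^sub>M U) ?T" using T by simp
    also have "\<dots> = (\<integral>\<^sup>+\<delta>. emeasure U (Pair \<delta> -` ?T) \<partial>P)"
      by (rule U.emeasure_pair_measure_alt[OF T])
    also have "\<dots> = (\<integral>\<^sup>+\<delta>. 0 \<partial>P)"
    proof (rule nn_integral_cong)
      fix \<delta>
      have im: "(x(j := y)) ` I = x ` I" if "I \<subseteq> J - {j}" for I y using that by auto
      have im': "(x(j := y)) ` insert j B = insert y (x ` B)" for y using J(3) im[of B y] by auto
      have mem: "opt_value (insert (\<delta>, \<tau>) (x ` B)) = opt_value (x ` (J - {j}))"
        "opt_value (insert (\<delta>, \<tau>) (x ` B)) < K"
        "opt_value (x ` B) < opt_value (insert (\<delta>, \<tau>) (x ` B))"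
        if "\<tau> \<in> Pair \<delta> -` ?T" for \<tau>
      proof -
        have "x(j := (\<delta>, \<tau>)) \<in> ?bad" using that by simp
        then show "opt_value (insert (\<delta>, \<tau>) (x ` B)) = opt_value (x ` (J - {j}))"
          "opt_value (insert (\<delta>, \<tau>) (x ` B)) < K"
          "opt_value (x ` B) < opt_value (insert (\<delta>, \<tau>) (x ` B))"
          unfolding mem_Collect_eq im' im[OF order_refl] im[OF J(3)] by auto
      qed
      have no: "\<not> \<bar>\<tau>\<bar> < \<bar>\<tau>'\<bar>" if "\<tau> \<in> Pair \<delta> -` ?T" "\<tau>' \<in> Pair \<delta> -` ?T" for \<tau> \<tau>'
        using opt_value_label_inj[of \<tau> \<tau>' \<delta> "x ` B"] mem[OF that(1)] mem[OF that(2)] by auto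
      show "emeasure U (Pair \<delta> -` ?T) = 0"
      proof (rule same_abs_null[OF U(2,3)])
        show "Pair \<delta> -` ?T \<in> sets U" by (rule sets_Pair1[OF T])
        show "\<bar>\<tau>\<bar> = \<bar>\<tau>'\<bar>" if "\<tau> \<in> Pair \<delta> -` ?T" "\<tau>' \<in> Pair \<delta> -` ?T" for \<tau> \<tau>'
          using no[OF that] no[OF that(2,1)] by linarith
      qed
    qed
    finally show "(\<integral>\<^sup>+y. indicator ?bad (x(j := y)) \<partial>(P \<Otimes>\<^sub>M U)) = 0" by simp
  qed
  finally have "emeasure ?M ?bad = 0" by simp
  then show ?thesis using bad by (intro AE_I[of _ _ ?bad]) (auto simp: not_le)
qed

lemma scenario_value_labelled:
  assumes P: "prob_space P" and U: "prob_space U" "sets U = sets borel" "\<And>r. emeasure U {r} = 0"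
    and row_meas: "\<And>x i. x \<in> X \<Longrightarrow> (\<lambda>\<delta>. u i x \<bullet> v \<delta>) \<in> borel_measurable P"
    and feas: "\<And>J :: nat set. finite J \<Longrightarrow> AE \<omega> in Pi\<^sub>M J (\<lambda>_. P \<Otimes>\<^sub>M U). opt_value (\<omega> ` J) < K"
  shows "scenario_value (P \<Otimes>\<^sub>M U) opt_value (CARD('r) * DIM('e))"
proof -
  interpret P: prob_space P by (rule P)
  interpret U: prob_space U by (rule U(1))
  interpret PU: pair_prob_space P U ..
  show ?thesis
  proof unfold_locales
    fix J :: "nat set" assume J: "finite J"
    show "(\<lambda>\<omega>. opt_value (\<omega> ` J)) \<in> borel_measurable (Pi\<^sub>M J (\<lambda>_. P \<Otimes>\<^sub>M U))"
      by (rule opt_value_measurable[OF row_meas U(2) J order_refl])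
    have "AE \<omega> in Pi\<^sub>M J (\<lambda>_. P \<Otimes>\<^sub>M U). \<forall>jB\<in>(SIGMA j:J. Pow (J - {j})). case jB of (j, B) \<Rightarrow>
        opt_value (insert (\<omega> j) (\<omega> ` B)) = opt_value (\<omega> ` (J - {j})) \<longrightarrow>
        opt_value (insert (\<omega> j) (\<omega> ` B)) < K \<longrightarrow> opt_value (insert (\<omega> j) (\<omega> ` B)) \<le> opt_value (\<omega> ` B)"
    proof (rule AE_finite_allI)
      show "finite (SIGMA j:J. Pow (J - {j}))" using J by auto
    next
      fix jB assume "jB \<in> (SIGMA j:J. Pow (J - {j}))"
      then obtain j B where jB: "jB = (j, B)" "j \<in> J" "B \<subseteq> J - {j}" by auto
      show "AE \<omega> in Pi\<^sub>M J (\<lambda>_. P \<Otimes>\<^sub>M U). case jB of (j, B) \<Rightarrow>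
        opt_value (insert (\<omega> j) (\<omega> ` B)) = opt_value (\<omega> ` (J - {j})) \<longrightarrow>
        opt_value (insert (\<omega> j) (\<omega> ` B)) < K \<longrightarrow> opt_value (insert (\<omega> j) (\<omega> ` B)) \<le> opt_value (\<omega> ` B)"
        unfolding jB(1) prod.case by (rule generic_label[OF P U row_meas J jB(2,3)])
    qed
    with feas[OF J] show "AE \<omega> in Pi\<^sub>M J (\<lambda>_. P \<Otimes>\<^sub>M U).
        opt_value (\<omega> ` {j \<in> J. opt_value (\<omega> ` (J - {j})) < opt_value (\<omega> ` J)}) = opt_value (\<omega> ` J)"
    proof eventually_elim
      case (elim \<omega>)
      show ?case by (rule opt_value_nondegenerate[OF J]) (use elim in auto)
    qed
  next
    fix A B :: "('d \<times> real) set" assume "A \<subseteq> B"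
    then show "opt_value A \<le> opt_value B" by (rule opt_value_mono)
  next
    fix A B :: "('d \<times> real) set" assume "\<And>s. s \<in> B \<Longrightarrow> opt_value (insert s A) = opt_value A"
    then show "opt_value (A \<union> B) = opt_value A" by (rule opt_value_local)
  next
    fix A :: "('d \<times> real) set" assume "finite A" "CARD('r) * DIM('e) < card A"
    then show "\<exists>a\<in>A. opt_value (A - {a}) = opt_value A" by (rule opt_value_helly)
  qed
qed

end

subsection \<open>The limit of vanishing relaxation\<close>

lemma compact_tendsto_if_unique_limit:
  fixes x :: "nat \<Rightarrow> 'a::metric_space"
  assumes X: "compact X" "\<And>n. x n \<in> X"
    and lim: "\<And>r l. strict_mono r \<Longrightarrow> (x \<circ> r) \<longlonglongrightarrow> l \<Longrightarrow> l = a"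
  shows "x \<longlonglongrightarrow> a"
proof (rule ccontr)
  assume "\<not> x \<longlonglongrightarrow> a"
  then obtain e where e: "0 < e" "\<exists>\<^sub>F n in sequentially. \<not> dist (x n) a < e"
    by (auto simp: tendsto_iff not_eventually)
  then have "infinite {n. \<not> dist (x n) a < e}"
    by (simp add: frequently_cofinite[symmetric] cofinite_eq_sequentially)
  then obtain r :: "nat \<Rightarrow> nat" where r: "strict_mono r" "\<And>n. r n \<in> {n. \<not> dist (x n) a < e}"
    using infinite_enumerate by blast
  obtain l q where q: "strict_mono q" "((x \<circ> r) \<circ> q) \<longlonglongrightarrow> l"
    using X unfolding compact_eq_seq_compact_metric seq_compact_def by (metis comp_apply)
  have "(x \<circ> (r \<circ> q)) \<longlonglongrightarrow> l" using q(2) by (simp add: comp_assoc)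
  moreover from lim[OF strict_mono_o[OF r(1) q(1)] this] have "l = a" .
  ultimately have "\<forall>\<^sub>F n in sequentially. dist ((x \<circ> (r \<circ> q)) n) a < e"
    using e(1) by (auto dest: tendstoD)
  then obtain n where "dist ((x \<circ> (r \<circ> q)) n) a < e" by (auto simp: eventually_sequentially)
  then show False using r(2)[of "q n"] by simp
qed

lemma inner_self_strict_convex:
  fixes x y :: "'a::real_inner"
  assumes "x \<noteq> y" "0 < \<mu>" "\<mu> < 1"
  shows "((1 - \<mu>) *\<^sub>R x + \<mu> *\<^sub>R y) \<bullet> ((1 - \<mu>) *\<^sub>R x + \<mu> *\<^sub>R y) < (1 - \<mu>) * (x \<bullet> x) + \<mu> * (y \<bullet> y)"
proof -
  have "(1 - \<mu>) * (x \<bullet> x) + \<mu> * (y \<bullet> y) - ((1 - \<mu>) *\<^sub>R x + \<mu> *\<^sub>R y) \<bullet> ((1 - \<mu>) *\<^sub>R x + \<mu> *\<^sub>R y)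
      = \<mu> * (1 - \<mu>) * ((x - y) \<bullet> (x - y))"
    by (simp add: inner_simps inner_commute algebra_simps)
  moreover have "0 < \<mu> * (1 - \<mu>) * ((x - y) \<bullet> (x - y))" using assms by simp
  ultimately show ?thesis by linarith
qed

text \<open>\<open>K_bound\<close> takes the quadratic term with coefficient 1; as
  \<open>rho n \<le> 1\<close>, one K serves all relaxed programs. Regularity is demanded for every
  \<delta>, which the final proof arranges by altering \<open>v\<close> on a null set.\<close>

locale bilinear_scenario =
  fixes X :: "'x::euclidean_space set" and c :: 'x and u :: "'r::finite \<Rightarrow> 'x \<Rightarrow> 'e::euclidean_space"
    and v :: "'d \<Rightarrow> 'e" and K :: real
  assumes X_compact: "compact X" and X_convex: "convex X"
    and K_bound: "\<And>x. x \<in> X \<Longrightarrow> c \<bullet> x + x \<bullet> x < K"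
    and rows_convex: "\<And>i \<delta>. convex_on X (\<lambda>x. u i x \<bullet> v \<delta>)"
    and rows_cont: "\<And>i \<delta>. continuous_on X (\<lambda>x. u i x \<bullet> v \<delta>)"
begin

definition rho :: "nat \<Rightarrow> real" where
  "rho n = 1 / real (Suc n)"

lemma rho_bounds: "0 < rho n" "0 \<le> rho n" "rho n \<le> 1"
  by (simp_all add: rho_def)

sublocale L: labelled_scenario X "\<lambda>x. c \<bullet> x + rho n * (x \<bullet> x)" u v "rho n" K for n
proof
  show "continuous_on X (\<lambda>x. c \<bullet> x + rho n * (x \<bullet> x))" by (intro continuous_intros)
next
  fix x y :: 'x and \<mu> :: real assume "x \<noteq> y" "0 < \<mu>" "\<mu> < 1"
  from inner_self_strict_convex[OF this] have "rho n * (((1 - \<mu>) *\<^sub>R x + \<mu> *\<^sub>R y) \<bullet> ((1 - \<mu>) *\<^sub>R x + \<mu> *\<^sub>R y))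
      < rho n * ((1 - \<mu>) * (x \<bullet> x) + \<mu> * (y \<bullet> y))"
    by (intro mult_strict_left_mono rho_bounds)
  then show "c \<bullet> ((1 - \<mu>) *\<^sub>R x + \<mu> *\<^sub>R y) + rho n * (((1 - \<mu>) *\<^sub>R x + \<mu> *\<^sub>R y) \<bullet> ((1 - \<mu>) *\<^sub>R x + \<mu> *\<^sub>R y))
      < (1 - \<mu>) * (c \<bullet> x + rho n * (x \<bullet> x)) + \<mu> * (c \<bullet> y + rho n * (y \<bullet> y))"
    by (simp add: inner_add_right distrib_left mult.left_commute)
next
  fix x assume "x \<in> X"
  moreover have "rho n * (x \<bullet> x) \<le> 1 * (x \<bullet> x)" by (intro mult_right_mono rho_bounds) auto
  ultimately show "c \<bullet> x + rho n * (x \<bullet> x) < K" using K_bound[of x] by simp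
qed (use X_compact X_convex rows_convex rows_cont rho_bounds in auto)

definition nominal :: "'d set \<Rightarrow> 'x set" where
  "nominal A = {x \<in> X. \<forall>\<delta>\<in>A. \<forall>i. u i x \<bullet> v \<delta> \<le> 0}"

lemma nominal_feasible: "x \<in> nominal (fst ` A) \<Longrightarrow> x \<in> L.feasible n A"
proof -
  assume x: "x \<in> nominal (fst ` A)"
  have "u i x \<bullet> v (fst s) \<le> rho n * \<bar>snd s\<bar>" if "s \<in> A" for i s
  proof -
    have "u i x \<bullet> v (fst s) \<le> 0" using x that by (auto simp: nominal_def)
    also have "0 \<le> rho n * \<bar>snd s\<bar>" by (simp add: rho_bounds)
    finally show ?thesis .
  qed
  then show ?thesis using x by (auto simp: nominal_def L.feasible_def L.satisfies_def)
qed

lemma rho_tendsto: "rho \<longlonglongrightarrow> 0"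
  unfolding rho_def by (rule LIMSEQ_Suc[OF lim_1_over_n])

text \<open>A subsequential limit meets the nominal constraints because the relaxations vanish, and
  costs no more than a because a is feasible for every relaxed program. Uniqueness of a identifies
  the two.\<close>

lemma perturbed_optimizers_tendsto:
  assumes a: "a \<in> nominal (fst ` A)" "\<And>y. y \<in> nominal (fst ` A) \<Longrightarrow> y \<noteq> a \<Longrightarrow> c \<bullet> a < c \<bullet> y"
    and x: "\<And>n. x n \<in> L.feasible n A" "\<And>n. c \<bullet> x n + rho n * (x n \<bullet> x n) = L.opt_value n A"
  shows "x \<longlonglongrightarrow> a"
proof (rule compact_tendsto_if_unique_limit[OF X_compact])
  show xX: "x n \<in> X" for n using x(1)[of n] by (simp add: L.feasible_def)
  fix r :: "nat \<Rightarrow> nat" and l assume r: "strict_mono r" and l: "(x \<circ> r) \<longlonglongrightarrow> l"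
  have lX: "l \<in> X"
    using compact_imp_closed[OF X_compact] xX l unfolding closed_sequential_limits by (metis comp_apply)
  have rho_r: "(\<lambda>n. rho (r n)) \<longlonglongrightarrow> 0"
    using LIMSEQ_subseq_LIMSEQ[OF rho_tendsto r] by (simp add: comp_def)
  have "u i l \<bullet> v (fst s) \<le> 0" if "s \<in> A" for i s
  proof (rule LIMSEQ_le)
    show "(\<lambda>n. u i (x (r n)) \<bullet> v (fst s)) \<longlonglongrightarrow> u i l \<bullet> v (fst s)"
      using rows_cont[of i "fst s", unfolded continuous_on_sequentially, rule_format, OF lX, of "x \<circ> r"] l xX
      by (simp add: comp_def)
    show "(\<lambda>n. rho (r n) * \<bar>snd s\<bar>) \<longlonglongrightarrow> 0" using tendsto_mult_left_zero[OF rho_r] by simp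
    show "\<exists>N. \<forall>n\<ge>N. u i (x (r n)) \<bullet> v (fst s) \<le> rho (r n) * \<bar>snd s\<bar>"
      using x(1) that by (auto simp: L.feasible_def L.satisfies_def)
  qed
  then have l_nom: "l \<in> nominal (fst ` A)" using lX by (auto simp: nominal_def)
  have "c \<bullet> l \<le> c \<bullet> a"
  proof (rule LIMSEQ_le)
    show "(\<lambda>n. c \<bullet> x (r n)) \<longlonglongrightarrow> c \<bullet> l" using l by (intro tendsto_inner tendsto_const) (simp add: comp_def)
    have "(\<lambda>n. c \<bullet> a + rho (r n) * (a \<bullet> a)) \<longlonglongrightarrow> c \<bullet> a + 0 * (a \<bullet> a)"
      by (intro tendsto_intros rho_r)
    then show "(\<lambda>n. c \<bullet> a + rho (r n) * (a \<bullet> a)) \<longlonglongrightarrow> c \<bullet> a" by simp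
    have "c \<bullet> x (r n) \<le> c \<bullet> a + rho (r n) * (a \<bullet> a)" for n
    proof -
      have "c \<bullet> x (r n) \<le> c \<bullet> x (r n) + rho (r n) * (x (r n) \<bullet> x (r n))" by (simp add: rho_bounds)
      also have "\<dots> \<le> c \<bullet> a + rho (r n) * (a \<bullet> a)"
        unfolding x(2) by (rule L.opt_value_le[OF nominal_feasible[OF a(1)]])
      finally show ?thesis .
    qed
    then show "\<exists>N. \<forall>n\<ge>N. c \<bullet> x (r n) \<le> c \<bullet> a + rho (r n) * (a \<bullet> a)" by blast
  qed
  then show "l = a" using a(2)[OF l_nom] by fastforce
qed

text \<open>Strict violation at the limit passes to the converging optimisers, for any fixed label.
  This is the pointwise source of lower semicontinuity of the violation probability.\<close>

lemma eventually_violated: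
  assumes a: "a \<in> nominal (fst ` A)" "\<And>y. y \<in> nominal (fst ` A) \<Longrightarrow> y \<noteq> a \<Longrightarrow> c \<bullet> a < c \<bullet> y"
    and viol: "0 < u i a \<bullet> v \<delta>"
  shows "\<forall>\<^sub>F n in sequentially. L.opt_value n A < L.opt_value n (insert (\<delta>, \<tau>) A)"
proof -
  have "L.opt_value n A < K" for n
    using L.opt_value_le[OF nominal_feasible[OF a(1)], of n] L.f_less[of a n] a(1) by (simp add: nominal_def)
  then have "\<forall>n. \<exists>x. x \<in> L.feasible n A \<and> c \<bullet> x + rho n * (x \<bullet> x) = L.opt_value n A"
    using L.opt_value_attained by blast
  from choice[OF this] obtain x where
    x: "\<And>n. x n \<in> L.feasible n A" "\<And>n. c \<bullet> x n + rho n * (x n \<bullet> x n) = L.opt_value n A"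
    by blast
  have xX: "x n \<in> X" for n using x(1)[of n] by (simp add: L.feasible_def)
  have aX: "a \<in> X" using a(1) by (simp add: nominal_def)
  have "(\<lambda>n. u i (x n) \<bullet> v \<delta>) \<longlonglongrightarrow> u i a \<bullet> v \<delta>"
    using rows_cont[of i \<delta>, unfolded continuous_on_sequentially, rule_format, OF aX, of x]
      perturbed_optimizers_tendsto[OF a x] xX
    by (simp add: comp_def)
  moreover have "(\<lambda>n. rho n * \<bar>\<tau>\<bar>) \<longlonglongrightarrow> 0" using tendsto_mult_left_zero[OF rho_tendsto] by simp
  ultimately have "(\<lambda>n. u i (x n) \<bullet> v \<delta> - rho n * \<bar>\<tau>\<bar>) \<longlonglongrightarrow> u i a \<bullet> v \<delta> - 0" by (rule tendsto_diff)
  then have "\<forall>\<^sub>F n in sequentially. 0 < u i (x n) \<bullet> v \<delta> - rho n * \<bar>\<tau>\<bar>"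
    using viol by (intro order_tendstoD(1)) auto
  then show ?thesis
  proof eventually_elim
    case (elim n)
    then have "\<not> L.satisfies n (x n) (\<delta>, \<tau>)" by (auto simp: L.satisfies_def not_le intro!: exI[of _ i])
    then have "L.opt_value n (insert (\<delta>, \<tau>) A) \<noteq> L.opt_value n A"
      using L.opt_value_insert_eq[OF x] by blast
    moreover have "L.opt_value n A \<le> L.opt_value n (insert (\<delta>, \<tau>) A)" by (rule L.opt_value_mono) auto
    ultimately show ?case by simp
  qed
qed

lemma prob_nominal_violation:
  assumes P: "prob_space P"
    and row_meas: "\<And>x i. x \<in> X \<Longrightarrow> (\<lambda>\<delta>. u i x \<bullet> v \<delta>) \<in> borel_measurable P"
    and feas: "\<And>J :: nat set. finite J \<Longrightarrow> AE \<omega> in Pi\<^sub>M J (\<lambda>_. P). nominal (\<omega> ` J) \<noteq> {}"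
    and J: "finite (J :: nat set)" "CARD('r) * DIM('e) \<le> card J"
    and \<epsilon>: "0 < \<epsilon>" "\<epsilon> < 1"
    and B: "B \<in> sets (Pi\<^sub>M J (\<lambda>_. P))"
    and viol: "AE \<omega> in Pi\<^sub>M J (\<lambda>_. P). \<omega> \<in> B \<longrightarrow> (\<exists>a \<in> nominal (\<omega> ` J).
      (\<forall>y\<in>nominal (\<omega> ` J). y \<noteq> a \<longrightarrow> c \<bullet> a < c \<bullet> y) \<and>
      \<epsilon> < measure P {\<delta> \<in> space P. \<exists>i. 0 < u i a \<bullet> v \<delta>})"
  shows "measure (Pi\<^sub>M J (\<lambda>_. P)) B \<le> binomial_cdf (CARD('r) * DIM('e)) (card J) (1 - \<epsilon>)"
proof -
  define U :: "real measure" where "U = uniform_measure lborel {0..1}"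
  have U: "prob_space U" "sets U = sets borel" "emeasure U {r} = 0" for r
  proof -
    show "prob_space U" unfolding U_def by (rule prob_space_uniform_measure) auto
    show "sets U = sets borel" by (simp add: U_def)
    have "emeasure lborel ({0..1} \<inter> {r}) = 0" by (rule emeasure_lborel_countable) auto
    then show "emeasure U {r} = 0" by (simp add: U_def)
  qed
  interpret P: prob_space P by (rule P)
  interpret U: prob_space U by (rule U(1))
  interpret PU: pair_prob_space P U ..
  let ?Q = "P \<Otimes>\<^sub>M U"
  \<comment> \<open>Forgetting the labels recovers the original sample law, so events and
    almost-sure statements can be pulled back.\<close>
  have proj: "distr (Pi\<^sub>M J (\<lambda>_. ?Q)) (Pi\<^sub>M J (\<lambda>_. P)) (compose J fst) = Pi\<^sub>M J (\<lambda>_. P)"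
    if "finite J" for J :: "nat set"
    using distr_PiM_finite_prob_space'[OF that, of "\<lambda>_. ?Q" "\<lambda>_. P" fst] U.distr_pair_fst[of P]
      PU.prob_space_axioms P by simp
  have proj_meas: "compose J fst \<in> measurable (Pi\<^sub>M J (\<lambda>_. ?Q)) (Pi\<^sub>M J (\<lambda>_. P))" for J :: "nat set"
    unfolding compose_def by measurable
  have proj_image: "compose J fst \<omega> ` J = fst ` \<omega> ` J" for J and \<omega> :: "nat \<Rightarrow> 'd \<times> real"
    by (auto simp: compose_def image_iff)
  have lift: "AE \<omega> in Pi\<^sub>M J (\<lambda>_. ?Q). R (compose J fst \<omega>)" if "finite J" "AE \<omega> in Pi\<^sub>M J (\<lambda>_. P). R \<omega>"
    for J :: "nat set" and R
  proof (rule AE_distrD[OF proj_meas])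
    show "AE \<omega> in distr (Pi\<^sub>M J (\<lambda>_. ?Q)) (Pi\<^sub>M J (\<lambda>_. P)) (compose J fst). R \<omega>"
      unfolding proj[OF that(1)] by (rule that(2))
  qed
  interpret S: scenario_value ?Q "L.opt_value n" "CARD('r) * DIM('e)" for n
  proof (rule L.scenario_value_labelled[OF P U row_meas])
    fix J :: "nat set" assume J: "finite J"
    from lift[OF J feas[OF J]] show "AE \<omega> in Pi\<^sub>M J (\<lambda>_. ?Q). L.opt_value n (\<omega> ` J) < K"
    proof eventually_elim
      case (elim \<omega>)
      then obtain a where a: "a \<in> nominal (fst ` \<omega> ` J)" unfolding proj_image by blast
      then show ?case
        using L.opt_value_le[OF nominal_feasible[OF a], of n] L.f_less[of a n] by (simp add: nominal_def)
    qed
  qed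
  let ?M = "Pi\<^sub>M J (\<lambda>_. ?Q)" and ?T = "binomial_cdf (CARD('r) * DIM('e)) (card J) (1 - \<epsilon>)"
  interpret M: prob_space ?M by (intro prob_space_PiM PU.prob_space_axioms)
  define E where "E n = {\<omega> \<in> space ?M. \<epsilon> < S.violation n (\<omega> ` J)}" for n
  have E: "E n \<in> sets ?M" for n
    unfolding E_def by (intro borel_measurable_less borel_measurable_const S.violation_measurable J)
  have E_le: "measure ?M (E n) \<le> ?T" for n
    unfolding E_def by (rule S.prob_violation_tail[OF J _ \<epsilon>]) simp
  define F where "F k = (\<Inter>n\<in>{k..}. E n)" for k
  have F: "F k \<in> sets ?M" for k unfolding F_def using E by (intro sets.countable_INT) auto
  have F_le: "measure ?M (F k) \<le> ?T" for k
    using M.finite_measure_mono[of "F k" "E k"] E E_le[of k] by (auto simp: F_def intro: order_trans)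
  \<comment> \<open>The union of the F k is the limit inferior of the E n, and it inherits the
    common bound by continuity from below.\<close>
  have F_inc: "incseq F" by (auto simp: incseq_def F_def)
  have "(\<lambda>k. measure ?M (F k)) \<longlonglongrightarrow> measure ?M (\<Union>k. F k)"
    using F F_inc by (intro M.finite_Lim_measure_incseq) auto
  then have UF: "measure ?M (\<Union>k. F k) \<le> ?T" using F_le by (intro LIMSEQ_le_const2) auto
  let ?B = "compose J fst -` B \<inter> space ?M"
  have B': "?B \<in> sets ?M" by (rule measurable_sets[OF proj_meas B])
  have "measure (Pi\<^sub>M J (\<lambda>_. P)) B = measure ?M ?B"
    using measure_distr[OF proj_meas[of J] B] unfolding proj[OF J(1)] .
  also have "\<dots> \<le> measure ?M (\<Union>k. F k)"
  proof (rule M.finite_measure_mono_AE)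
    show "(\<Union>k. F k) \<in> sets ?M" using F by auto
    show "AE \<omega> in ?M. \<omega> \<in> ?B \<longrightarrow> \<omega> \<in> (\<Union>k. F k)"
      using lift[OF J(1) viol] AE_space
    proof eventually_elim
      case (elim \<omega>)
      let ?A = "\<omega> ` J"
      show ?case
      proof
        assume "\<omega> \<in> ?B"
        then obtain a where a: "a \<in> nominal (fst ` ?A)" "\<And>y. y \<in> nominal (fst ` ?A) \<Longrightarrow> y \<noteq> a \<Longrightarrow> c \<bullet> a < c \<bullet> y"
          and big: "\<epsilon> < measure P {\<delta> \<in> space P. \<exists>i. 0 < u i a \<bullet> v \<delta>}"
          using elim(1) unfolding proj_image by blast
        let ?D = "{\<delta> \<in> space P. \<exists>i. 0 < u i a \<bullet> v \<delta>}"
        have aX: "a \<in> X" using a(1) by (simp add: nominal_def)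
        have D: "?D \<in> sets P"
          by (intro sets.sets_Collect_countable_Ex borel_measurable_less borel_measurable_const row_meas aX)
        \<comment> \<open>The same limit inferior for one new sample: the W k increase to a set of
          measure above \<epsilon>, so some W k already exceeds \<epsilon>, and it bounds all later
          violations from below. Strictness in \<open>viol\<close> is what makes this
          possible.\<close>
        define W where "W k = (\<Inter>n\<in>{k..}. {s \<in> space ?Q. S.violated n ?A s})" for k
        have W1: "{s \<in> space ?Q. S.violated n ?A s} \<in> sets ?Q" for n
          by (rule S.violated_section_sets[OF J(1) elim(2)])
        have W: "W k \<in> sets ?Q" for k unfolding W_def using W1 by (intro sets.countable_INT) auto
        have "\<epsilon> < measure ?Q (?D \<times> space U)"
          using big D U.emeasure_pair_measure_Times[OF D sets.top[of U]]
          by (simp add: measure_def U.emeasure_space_1)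
        also have "\<dots> \<le> measure ?Q (\<Union>k. W k)"
        proof (rule PU.finite_measure_mono)
          show "(\<Union>k. W k) \<in> sets ?Q" using W by auto
          show "?D \<times> space U \<subseteq> (\<Union>k. W k)"
          proof
            fix s assume "s \<in> ?D \<times> space U"
            then obtain \<delta> \<tau> i where s: "s = (\<delta>, \<tau>)" "\<delta> \<in> space P" "\<tau> \<in> space U" "0 < u i a \<bullet> v \<delta>" by auto
            from eventually_violated[OF a s(4), of \<tau>] obtain k where
              "\<And>n. k \<le> n \<Longrightarrow> S.violated n ?A s"
              unfolding eventually_sequentially S.violated_def s(1) by blast
            then have "s \<in> W k" using s by (auto simp: W_def space_pair_measure)
            then show "s \<in> (\<Union>k. W k)" by blast
          qed
        qed
        finally have "\<epsilon> < measure ?Q (\<Union>k. W k)" .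
        moreover have "(\<lambda>k. measure ?Q (W k)) \<longlonglongrightarrow> measure ?Q (\<Union>k. W k)"
          using W by (intro PU.finite_Lim_measure_incseq) (auto simp: incseq_def W_def)
        ultimately have "\<forall>\<^sub>F k in sequentially. \<epsilon> < measure ?Q (W k)" by (intro order_tendstoD(1))
        then obtain k where k: "\<epsilon> < measure ?Q (W k)" by (auto simp: eventually_sequentially)
        have "\<epsilon> < S.violation n ?A" if "k \<le> n" for n
        proof -
          have "measure ?Q (W k) \<le> measure ?Q {s \<in> space ?Q. S.violated n ?A s}"
            using that W1 by (intro PU.finite_measure_mono) (auto simp: W_def)
          then show ?thesis using k by (simp add: S.violation_def)
        qed
        then have "\<omega> \<in> F k" using elim(2) by (auto simp: F_def E_def)
        then show "\<omega> \<in> (\<Union>k. F k)" by blast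
      qed
    qed
  qed
  finally show ?thesis using UF by linarith
qed

end

section \<open>Transfer to the scenario program\<close>

lemma AE_PiM_reindex_image:
  assumes M: "prob_space M" and J: "finite (J :: nat set)"
    and AE: "AE \<omega> in Pi\<^sub>M {1..card J} (\<lambda>_. M). R (\<omega> ` {1..card J})"
  shows "AE \<omega> in Pi\<^sub>M J (\<lambda>_. M). R (\<omega> ` J)"
proof -
  let ?n = "{1..card J}"
  obtain f where f: "bij_betw f ?n J"
    using ex_bij_betw_nat_finite_1[OF J] by blast
  let ?t = "\<lambda>\<omega>. \<lambda>n\<in>?n. \<omega> (f n)"
  have "distr (Pi\<^sub>M J (\<lambda>_. M)) (Pi\<^sub>M ?n (\<lambda>_. M)) ?t = Pi\<^sub>M ?n (\<lambda>_. M)"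
    using distr_PiM_reindex[of J "\<lambda>_. M" f ?n] f M by (auto simp: bij_betw_def)
  note d = this
  have t: "?t \<in> measurable (Pi\<^sub>M J (\<lambda>_. M)) (Pi\<^sub>M ?n (\<lambda>_. M))"
    using f by (intro measurable_restrict measurable_component_singleton) (auto simp: bij_betw_def)
  have AE': "AE \<omega> in Pi\<^sub>M J (\<lambda>_. M). R (?t \<omega> ` ?n)"
    by (rule AE_distrD[OF t]) (unfold d, rule AE)
  have "?t \<omega> ` ?n = \<omega> ` f ` ?n" for \<omega> by (auto simp del: atLeastAtMost_iff)
  then have "?t \<omega> ` ?n = \<omega> ` J" for \<omega> using f by (simp add: bij_betw_def)
  then have "R (?t \<omega> ` ?n) \<longleftrightarrow> R (\<omega> ` J)" for \<omega> by (rule arg_cong)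
  then show ?thesis using AE' by (auto elim: eventually_mono)
qed

lemma sp_solution_unique:
  assumes "\<exists>!x. is_sp_optimizer c X g N \<omega> x"
  shows "sp_solution c X g N \<omega> \<in> sp_feasible_set X g N \<omega>"
    and "y \<in> sp_feasible_set X g N \<omega> \<Longrightarrow> y \<noteq> sp_solution c X g N \<omega> \<Longrightarrow> c \<bullet> sp_solution c X g N \<omega> < c \<bullet> y"
proof -
  let ?x = "sp_solution c X g N \<omega>"
  have x: "is_sp_optimizer c X g N \<omega> ?x"
    using someI_ex[OF ex1_implies_ex[OF assms]]
    by (simp add: sp_solution_def is_sp_optimizer_def arg_min_on_def arg_min_def)
  then show "?x \<in> sp_feasible_set X g N \<omega>" by (simp add: is_sp_optimizer_def is_arg_min_def)
  assume y: "y \<in> sp_feasible_set X g N \<omega>" "y \<noteq> ?x"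
  then have "\<not> is_sp_optimizer c X g N \<omega> y" using x assms by auto
  then obtain w where "w \<in> sp_feasible_set X g N \<omega>" "c \<bullet> w < c \<bullet> y"
    using y(1) by (auto simp: is_sp_optimizer_def is_arg_min_def)
  moreover have "\<not> c \<bullet> w < c \<bullet> ?x" using x calculation(1) by (auto simp: is_sp_optimizer_def is_arg_min_def)
  ultimately show "c \<bullet> ?x < c \<bullet> y" by linarith
qed

text \<open>The sum is then the full binomial expansion of 1. As \<beta> < 1, the hypothesis on N
  forces N \<ge> z.\<close>

lemma binomial_cdf_lessThan:
  assumes "N < z"
  shows "binomial_cdf z N x = 1"
proof -
  have "binomial_cdf z N x = (\<Sum>j\<le>N. real (N choose j) * (1 - x) ^ j * x ^ (N - j))"
    unfolding binomial_cdf_def using assms by (intro sum.mono_neutral_right) auto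
  also have "\<dots> = (1 - x + x) ^ N" using binomial_ring[of "1 - x" x N] by simp
  finally show ?thesis by simp
qed

theorem theorem1:
  fixes P :: "(real ^ 'd) measure"
    and \<Delta> :: "(real ^ 'd) set"
    and X :: "(real ^ 'n) set"
    and c :: "real ^ 'n"
    and g :: "real ^ 'n \<Rightarrow> real ^ 'd \<Rightarrow> real ^ 'r"
    and G :: "real ^ 'n \<Rightarrow> real ^ 'd ^ 'r"
    and H :: "real ^ 'n \<Rightarrow> real ^ 'r"
    and \<epsilon> \<beta> :: real
    and N :: nat
  assumes prob: "prob_space P"
    and space: "space P = \<Delta>"
    and X: "compact X" "convex X"
    and g_form: "\<And>x \<delta>. \<delta> \<in> \<Delta> \<Longrightarrow> g x \<delta> = G x *v \<delta> + H x"
    and g_regular: "AE \<delta> in P. \<forall>i. convex_on UNIV (\<lambda>x. g x \<delta> $ i) \<and> lower_semicontinuous (\<lambda>x. g x \<delta> $ i)"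
    and sp_feasible: "\<And>k. k \<ge> 1 \<Longrightarrow> AE \<omega> in sample_law k P. sp_feasible_set X g k \<omega> \<noteq> {}"
    and sp_unique: "\<And>k. k \<ge> 1 \<Longrightarrow> AE \<omega> in sample_law k P. \<exists>!x. is_sp_optimizer c X g k \<omega> x"
    and g_measurable: "\<And>x. x \<in> X \<Longrightarrow> g x \<in> borel_measurable P"
    and eps: "0 < \<epsilon>" "\<epsilon> < 1"
    and beta: "0 < \<beta>" "\<beta> < 1"
    and N_bound: "(\<Sum>j = 0..CARD('r) * (CARD('d) + 1) - 1. real (N choose j) * \<epsilon> ^ j * (1 - \<epsilon>) ^ (N - j)) \<le> \<beta>"
    and event_measurable:
      "{\<omega> \<in> space (sample_law N P). sp_solution c X g N \<omega> \<in> ccp_feasible_set P X g \<epsilon>} \<in> sets (sample_law N P)"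
  shows "measure (sample_law N P)
      {\<omega> \<in> space (sample_law N P). sp_solution c X g N \<omega> \<in> ccp_feasible_set P X g \<epsilon>} \<ge> 1 - \<beta>"
proof -
  interpret P: prob_space P by (rule prob)
  let ?z = "CARD('r) * (CARD('d) + 1)"
  have z: "0 < ?z" by simp
  have "{..<m} = {0..m - 1}" if "0 < m" for m :: nat using that by auto
  from this[OF z] have "{..<?z} = {0..?z - 1}" .
  then have cdf: "binomial_cdf ?z N (1 - \<epsilon>) \<le> \<beta>"
    using N_bound by (simp add: binomial_cdf_def)
  then have N: "?z \<le> N" using binomial_cdf_lessThan[of N ?z "1 - \<epsilon>"] beta by force
  then have N1: "1 \<le> N" using z by linarith

  obtain \<N> where \<N>: "\<N> \<in> null_sets P"
    "{\<delta> \<in> space P. \<not> (\<forall>i. convex_on UNIV (\<lambda>x. g x \<delta> $ i) \<and> lower_semicontinuous (\<lambda>x. g x \<delta> $ i))} \<subseteq> \<N>"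
    using g_regular unfolding eventually_ae_filter by blast
  define R where "R = space P - \<N>"
  have R_sets: "R \<in> sets P" using \<N>(1) by (auto simp: R_def)
  have R_AE: "AE \<delta> in P. \<delta> \<in> R"
    using AE_not_in[OF \<N>(1)] AE_space by eventually_elim (simp add: R_def)
  have R_convex: "convex_on UNIV (\<lambda>x. g x \<delta> $ i)" if "\<delta> \<in> R" for \<delta> i
    using that \<N>(2) by (auto simp: R_def)

  \<comment> \<open>Row i of g is the inner product of (G_i, H_i) with (\<delta>, 1) in dimension d
    + 1, so r rows give z = r(d + 1). Off R, \<open>v\<close> is 0 and the constraint trivial, which
    makes rows convex for every \<delta>.\<close>
  define u :: "'r \<Rightarrow> real ^ 'n \<Rightarrow> (real ^ 'd) \<times> real" where "u i x = (G x $ i, H x $ i)" for i x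
  define v :: "real ^ 'd \<Rightarrow> (real ^ 'd) \<times> real" where "v \<delta> = (if \<delta> \<in> R then (\<delta>, 1) else 0)" for \<delta>
  have uv: "u i x \<bullet> v \<delta> = (if \<delta> \<in> R then g x \<delta> $ i else 0)" for i x \<delta>
    using g_form[of \<delta> x] space
    by (simp add: u_def v_def R_def inner_vec_def matrix_vector_mult_def)
  have row_convex: "convex_on X (\<lambda>x. u i x \<bullet> v \<delta>)" for i \<delta>
    unfolding uv using convex_on_subset[OF R_convex] X(2) by (cases "\<delta> \<in> R") (auto simp: convex_on_const)
  \<comment> \<open>A real-valued convex function on the whole space is continuous.\<close>
  have row_cont: "continuous_on X (\<lambda>x. u i x \<bullet> v \<delta>)" for i \<delta>
    unfolding uv
    using continuous_on_subset[OF convex_on_continuous[OF open_UNIV R_convex]] by (cases "\<delta> \<in> R") auto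
  have row_meas: "(\<lambda>\<delta>. u i x \<bullet> v \<delta>) \<in> borel_measurable P" if "x \<in> X" for x i
  proof -
    have "(\<lambda>\<delta>. g x \<delta> $ i) \<in> borel_measurable P"
      using measurable_compose[OF g_measurable[OF that], of "\<lambda>y. y $ i" borel]
      by (simp add: borel_measurable_continuous_onI continuous_on_component)
    then show ?thesis unfolding uv using R_sets by measurable
  qed

  have "bounded ((\<lambda>x. c \<bullet> x + x \<bullet> x) ` X)"
    by (intro compact_imp_bounded compact_continuous_image X continuous_intros)
  then obtain K0 where "\<And>x. x \<in> X \<Longrightarrow> \<bar>c \<bullet> x + x \<bullet> x\<bar> \<le> K0" by (auto simp: bounded_iff)
  then have K: "c \<bullet> x + x \<bullet> x < K0 + 1" if "x \<in> X" for x using that by force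
  interpret L: bilinear_scenario X c u v "K0 + 1"
    by unfold_locales (use X K row_convex row_cont in auto)

  have samples: "AE \<omega> in sample_law k P. \<forall>j\<in>{1..k}. \<omega> j \<in> R" for k
    by (intro AE_finite_allI AE_PiM_component prob R_AE) auto
  have nominal: "L.nominal (\<omega> ` {1..k}) = sp_feasible_set X g k \<omega>" if "\<forall>j\<in>{1..k}. \<omega> j \<in> R" for k \<omega>
    using that by (auto simp: L.nominal_def sp_feasible_set_def uv less_eq_vec_def)
  have feas: "AE \<omega> in Pi\<^sub>M J (\<lambda>_. P). L.nominal (\<omega> ` J) \<noteq> {}" if J: "finite J" for J :: "nat set"
  proof (rule AE_PiM_reindex_image[OF prob J])
    show "AE \<omega> in sample_law (card J) P. L.nominal (\<omega> ` {1..card J}) \<noteq> {}"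
    proof (cases "card J = 0")
      \<comment> \<open>Feasibility is assumed from one sample on; for the empty index set,
        nonemptiness of X is read off from k = 1.\<close>
      case True
      interpret S: prob_space "sample_law 1 P" by (intro prob_space_PiM prob)
      have "X \<noteq> {}" using sp_feasible[of 1] by (auto simp: sp_feasible_set_def)
      then show ?thesis using True by (simp add: L.nominal_def)
    next
      case False
      then have "1 \<le> card J" by simp
      from sp_feasible[OF this] samples[of "card J"] show ?thesis
        by eventually_elim (simp only: nominal not_False_eq_True)
    qed
  qed

  let ?M = "sample_law N P"
  let ?good = "{\<omega> \<in> space ?M. sp_solution c X g N \<omega> \<in> ccp_feasible_set P X g \<epsilon>}"
  interpret M: prob_space ?M by (intro prob_space_PiM prob)
  have "measure ?M (space ?M - ?good) \<le> binomial_cdf (CARD('r) * DIM((real ^ 'd) \<times> real)) (card {1..N}) (1 - \<epsilon>)"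
  proof (rule L.prob_nominal_violation[OF prob row_meas feas _ _ eps])
    show "AE \<omega> in ?M. \<omega> \<in> space ?M - ?good \<longrightarrow> (\<exists>a \<in> L.nominal (\<omega> ` {1..N}).
      (\<forall>y\<in>L.nominal (\<omega> ` {1..N}). y \<noteq> a \<longrightarrow> c \<bullet> a < c \<bullet> y) \<and>
      \<epsilon> < measure P {\<delta> \<in> space P. \<exists>i. 0 < u i a \<bullet> v \<delta>})"
      using sp_unique[OF N1] samples[of N] AE_space
    proof eventually_elim
      case (elim \<omega>)
      let ?x = "sp_solution c X g N \<omega>"
      note nom = nominal[OF elim(2)]
      have xX: "?x \<in> X" using sp_solution_unique(1)[OF elim(1)] by (simp add: sp_feasible_set_def)
      show ?case
      proof
        assume "\<omega> \<in> space ?M - ?good"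
        then have "measure P {\<delta> \<in> space P. g ?x \<delta> \<le> 0} < 1 - \<epsilon>"
          using xX by (auto simp: ccp_feasible_set_def)
        \<comment> \<open>Passing from g to u and v alters the events only outside R, a null
          set.\<close>
        moreover have "measure P {\<delta> \<in> space P. \<exists>i. 0 < u i ?x \<bullet> v \<delta>} = 1 - measure P {\<delta> \<in> space P. g ?x \<delta> \<le> 0}"
        proof -
          have m: "{\<delta> \<in> space P. \<exists>i. 0 < u i ?x \<bullet> v \<delta>} \<in> sets P"
            by (intro sets.sets_Collect_countable_Ex borel_measurable_less borel_measurable_const row_meas xX)
          have m': "{\<delta> \<in> space P. g ?x \<delta> \<le> 0} \<in> sets P"
          proof -
            have "{\<delta> \<in> space P. g ?x \<delta> \<le> 0} = g ?x -` {..0} \<inter> space P" by auto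
            then show ?thesis using measurable_sets[OF g_measurable[OF xX], of "{..0}"] by simp
          qed
          have "measure P {\<delta> \<in> space P. g ?x \<delta> \<le> 0}
              = measure P (space P - {\<delta> \<in> space P. \<exists>i. 0 < u i ?x \<bullet> v \<delta>})"
          proof (rule P.finite_measure_eq_AE)
            show "AE \<delta> in P. \<delta> \<in> {\<delta> \<in> space P. g ?x \<delta> \<le> 0}
                \<longleftrightarrow> \<delta> \<in> space P - {\<delta> \<in> space P. \<exists>i. 0 < u i ?x \<bullet> v \<delta>}"
              using R_AE by eventually_elim (auto simp: uv less_eq_vec_def not_less)
          qed (use m m' in auto)
          then show ?thesis using P.prob_compl[OF m] by simp
        qed
        ultimately have "\<epsilon> < measure P {\<delta> \<in> space P. \<exists>i. 0 < u i ?x \<bullet> v \<delta>}" by simp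
        then show "\<exists>a \<in> L.nominal (\<omega> ` {1..N}).
            (\<forall>y\<in>L.nominal (\<omega> ` {1..N}). y \<noteq> a \<longrightarrow> c \<bullet> a < c \<bullet> y) \<and>
            \<epsilon> < measure P {\<delta> \<in> space P. \<exists>i. 0 < u i a \<bullet> v \<delta>}"
          unfolding nom using sp_solution_unique[OF elim(1)] by blast
      qed
    qed
  qed (use event_measurable N in auto)
  also have "\<dots> \<le> \<beta>" using cdf by simp
  finally have "measure ?M (space ?M - ?good) \<le> \<beta>" .
  then show ?thesis using M.prob_compl[OF event_measurable] by simp
qed

end
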